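(* Let the setting, the standing assumptions on $\mathcal{V},\mathcal{H},\mathcal{Q},\mathcal{A},\mathcal{B},f,g$, the one-step maps $\Psi_\tau$ and the random perturbations $\xi^n$ be as described in the context. That is, $\Psi_\tau$ satisfies the deterministic-scheme assumption with order $q>0$, and the noise satisfies the random-noise assumption with order $p>0$. Consider step sizes $\tau=T/N$, $N\in\mathbb{N}$, with $\tau\le 1$ and $\tau\le\tau^*$, where $\tau^*$ is the step size bound from the deterministic-scheme assumption. Let $u$ be the solution of the constrained system and let $U^n$ be the probabilistic approximations. Then there exists a constant $C>0$ independent of the step size $\tau$ such that $$\sup_{n\in\{0,1,\dots,N\}}\big(\mathbb{E}\,\|u(t^n)-U^n\|_{\mathcal{H}}^2\big)^{1/2}\le C\,\tau^{\min\{p,q\}}.$$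
   Context: **Spaces and operators.** $\mathcal{V},\mathcal{Q}$ are Hilbert spaces and $\mathcal{V},\mathcal{H},\mathcal{V}^*$ is a Gelfand triple. $T>0$ is a final time. - $\mathcal{B}\colon\mathcal{V}\to\mathcal{Q}^*$ is linear and continuous and satisfies an inf-sup condition: there is $\beta>0$ with $\inf_{q\in\mathcal{Q}\setminus\{0\}}\sup_{v\in\mathcal{V}\setminus\{0\}}\frac{\langle\mathcal{B}v,q\rangle}{\|v\|_{\mathcal{V}}\|q\|_{\mathcal{Q}}}\ge\beta$. - $\mathcal{V}_{\ker}:=\ker\mathcal{B}$. - $\mathcal{A}\colon\mathcal{V}\to\mathcal{V}^*$ is linear, continuous, and elliptic on $\mathcal{V}_{\ker}$ (there is $\alpha>0$ with $\langle\mathcal{A}v,v\rangle\ge\alpha\|v\|_{\mathcal{V}}^2$ for all $v\in\mathcal{V}_{\ker}$). - The right-hand sides $f,g$ are sufficiently smooth to guarantee existence of a unique solution of the system below. Moreover $f$ maps $[0,T]\times\mathcal{V}$ into $\mathcal{H}$ and there is $L_f>0$ with $\|f(t,v_1)-f(t,v_2)\|_{\mathcal{H}}\le L_f\|v_1-v_2\|_{\mathcal{H}}$. **Constrained system.** $u\colon[0,T]\to\mathcal{V}$ and $\lambda\colon[0,T]\to\mathcal{Q}$ solve, for almost every $t\in[0,T]$, $$\dot u(t)+\mathcal{A}u(t)+\mathcal{B}^*\lambda(t)=f(t,u)\ \text{in }\mathcal{V}^*,\qquad \mathcal{B}u(t)=g(t)\ \text{in }\mathcal{Q}^*,$$ with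 initial data $u(0)=u^0$ that is consistent, i.e. $\mathcal{B}u^0=g(0)$. **Decomposition.** $\mathcal{B}^-\colon\mathcal{Q}^*\to\mathcal{V}$ is a continuous linear right-inverse of $\mathcal{B}$, and $\mathcal{V}_c:=\operatorname{im}\mathcal{B}^-$, so that $\mathcal{V}=\mathcal{V}_{\ker}\oplus\mathcal{V}_c$. Write $u=u_{\ker}+u_c$ with $u_c(t)=\mathcal{B}^-g(t)$ and $u_{\ker}(t)\in\mathcal{V}_{\ker}$. **Time grid.** $\tau=T/N$ with $N\in\mathbb{N}$, and $t^n=n\tau$. **Deterministic-scheme assumption (order $q$).** $\Psi_\tau\colon[0,T]\times\mathcal{V}_{\ker}\to\mathcal{V}_{\ker}$ is a one-step map. The deterministic approximations are $u^{n+1}_{\ker}=\Psi_\tau(t^n,u^n_{\ker})$ with $u^0_{\ker}=u_{\ker}(0)$. There are constants $\tau^*,C_{\det},q,L_\Psi>0$ such that for all step sizes $\tau\in[0,\tau^*]$: 1. $\|u_{\ker}(t^n)-u^n_{\ker}\|_{\mathcal{H}}\le C_{\det}\,\tau^q$ for all $t^n\in[0,T]$; 2. $\|\Psi_\tau(t,v_1)-\Psi_\tau(t,v_2)\|_{\mathcal{H}}\le(1+L_\Psi\tau)\|v_1-v_2\|_{\mathcal{H}}$ for all $t\in[0,T]$ and $v_1,v_2\in\mathcal{V}_{\ker}$. **Random-noise assumption (order $p$).** On a probability space $(\Omega,\mathcal{F},\mathbb{P})$ with expectation $\mathbb{E}$, let $\chi^n$, $n=0,1,\dots$, be centered Gaussian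 processes with values in $\mathcal{V}_{\ker}$, with $\chi^n(s)\sim\mathcal{N}(0,\sigma^2)$ for a noise scale $\sigma\in\mathbb{R}$, i.i.d. over the different time steps $n$. Put $\xi^n(t)=\int_0^t\chi^n(s)\,\mathrm{d}s$. There are constants $C_\xi,p>0$, independent of $\tau$, such that $\mathbb{E}\|\xi^n(t)\|_{\mathcal{H}}^2\le C_\xi\,t^{2p+1}$ for all $t\in[0,\tau]$. In particular the $\xi^n(\tau)$ are i.i.d. centered Gaussian random variables with values in $\mathcal{V}_{\ker}$. **Probabilistic scheme.** $U^0=u^0$ and $U^n=U^n_{\ker}+\mathcal{B}^-g(t^n)$ with $U^n_{\ker}\in\mathcal{V}_{\ker}$, $U^0_{\ker}=u_{\ker}(0)$, and $$U^{n+1}_{\ker}=\Psi_\tau(t^n,U^n_{\ker})+\xi^n(\tau).$$ *)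

theory Defs
  imports "HOL-Probability.Probability"
begin

text \<open>
  The Hilbert spaces V, H, Q are types of class \<open>{real_inner, complete_space}\<close>; no separability is
  assumed. The dual of V is \<open>'v \<Rightarrow>\<^sub>L real\<close>, and an operator from V to the dual of Q has type
  \<open>'v \<Rightarrow>\<^sub>L 'q \<Rightarrow>\<^sub>L real\<close>, so that \<open>blinfun_apply (blinfun_apply B v) q\<close> is the duality pairing of
  \<open>B v\<close> and \<open>q\<close>. The inclusion of V into H is an explicit map \<open>\<iota>\<close>; the H-norm of \<open>v\<close> in V is
  \<open>norm (blinfun_apply \<iota> v)\<close>.
\<close>

subsection \<open>Spaces and operators\<close>

definition gelfand_triple ::
  "('v::{real_inner, complete_space} \<Rightarrow>\<^sub>L 'h::{real_inner, complete_space}) \<Rightarrow> bool" where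
  "gelfand_triple \<iota> \<longleftrightarrow> inj (blinfun_apply \<iota>) \<and> closure (range (blinfun_apply \<iota>)) = UNIV"

text \<open>The second embedding of the triple: H is identified with its dual by the Riesz map.\<close>

definition pivot :: "('v::real_inner \<Rightarrow>\<^sub>L 'h::real_inner) \<Rightarrow> 'h \<Rightarrow> ('v \<Rightarrow>\<^sub>L real)" where
  "pivot \<iota> h = blinfun_inner_right h o\<^sub>L \<iota>"

definition inf_sup_condition ::
  "('v::real_normed_vector \<Rightarrow>\<^sub>L 'q::real_normed_vector \<Rightarrow>\<^sub>L real) \<Rightarrow> real \<Rightarrow> bool" where
  "inf_sup_condition B \<beta> \<longleftrightarrow>
     (INF q\<in>UNIV - {0}. SUP v\<in>UNIV - {0}.
        ereal (blinfun_apply (blinfun_apply B v) q / (norm v * norm q))) \<ge> ereal \<beta>"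

definition op_ker :: "('v::real_normed_vector \<Rightarrow>\<^sub>L 'q::real_normed_vector) \<Rightarrow> 'v set" where
  "op_ker B = {v. blinfun_apply B v = 0}"

definition elliptic_on ::
  "'v set \<Rightarrow> ('v::real_normed_vector \<Rightarrow>\<^sub>L 'v \<Rightarrow>\<^sub>L real) \<Rightarrow> real \<Rightarrow> bool" where
  "elliptic_on W A \<alpha> \<longleftrightarrow> (\<forall>v\<in>W. blinfun_apply (blinfun_apply A v) v \<ge> \<alpha> * (norm v)\<^sup>2)"

definition dual_op ::
  "('v::real_normed_vector \<Rightarrow>\<^sub>L 'q::real_normed_vector \<Rightarrow>\<^sub>L real) \<Rightarrow> 'q \<Rightarrow> ('v \<Rightarrow>\<^sub>L real)" where
  "dual_op B q = Blinfun (\<lambda>v. blinfun_apply (blinfun_apply B v) q)"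

lemma dual_op_apply [simp]:
  "blinfun_apply (dual_op B q) v = blinfun_apply (blinfun_apply B v) q"
  unfolding dual_op_def
  by (subst bounded_linear_Blinfun_apply) (auto intro!: bounded_linear_intros)

subsection \<open>Solutions of the constrained system\<close>

definition abs_continuous :: "real \<Rightarrow> (real \<Rightarrow> 'x::real_normed_vector) \<Rightarrow> bool" where
  "abs_continuous T y \<longleftrightarrow>
     (\<forall>e>0. \<exists>d>0. \<forall>P. finite P \<longrightarrow> (\<forall>(s, t)\<in>P. 0 \<le> s \<and> s \<le> t \<and> t \<le> T) \<longrightarrow>
        disjoint_family_on (\<lambda>(s, t). {s<..<t}) P \<longrightarrow>
        (\<Sum>(s, t)\<in>P. t - s) < d \<longrightarrow> (\<Sum>(s, t)\<in>P. norm (y t - y s)) < e)"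

text \<open>
  The time derivative is taken in the dual of V. Absolute continuity makes the almost everywhere
  derivative of \<open>u\<close> also its generalized derivative, and it fixes \<open>u\<close> at every time.
\<close>

definition solves_system ::
  "real \<Rightarrow> ('v::real_inner \<Rightarrow>\<^sub>L 'h::real_inner) \<Rightarrow> ('v \<Rightarrow>\<^sub>L 'v \<Rightarrow>\<^sub>L real) \<Rightarrow>
   ('v \<Rightarrow>\<^sub>L 'q::real_normed_vector \<Rightarrow>\<^sub>L real) \<Rightarrow> (real \<Rightarrow> 'v \<Rightarrow> 'h) \<Rightarrow> (real \<Rightarrow> ('q \<Rightarrow>\<^sub>L real)) \<Rightarrow>
   'v \<Rightarrow> (real \<Rightarrow> 'v) \<Rightarrow> (real \<Rightarrow> 'q) \<Rightarrow> bool" where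
  "solves_system T \<iota> A B f g u0 u lam \<longleftrightarrow>
     abs_continuous T (\<lambda>t. pivot \<iota> (blinfun_apply \<iota> (u t))) \<and>
     (AE t in lborel. t \<in> {0..T} \<longrightarrow>
        (\<exists>du. ((\<lambda>s. pivot \<iota> (blinfun_apply \<iota> (u s))) has_vector_derivative du) (at t within {0..T}) \<and>
              du + blinfun_apply A (u t) + dual_op B (lam t) = pivot \<iota> (f t (u t))) \<and>
        blinfun_apply B (u t) = g t) \<and>
     u 0 = u0"

text \<open>Uniqueness is for \<open>u\<close> at every time, and for the multiplier almost everywhere.\<close>

definition unique_solution ::
  "real \<Rightarrow> ('v::real_inner \<Rightarrow>\<^sub>L 'h::real_inner) \<Rightarrow> ('v \<Rightarrow>\<^sub>L 'v \<Rightarrow>\<^sub>L real) \<Rightarrow>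
   ('v \<Rightarrow>\<^sub>L 'q::real_normed_vector \<Rightarrow>\<^sub>L real) \<Rightarrow> (real \<Rightarrow> 'v \<Rightarrow> 'h) \<Rightarrow> (real \<Rightarrow> ('q \<Rightarrow>\<^sub>L real)) \<Rightarrow>
   'v \<Rightarrow> (real \<Rightarrow> 'v) \<Rightarrow> (real \<Rightarrow> 'q) \<Rightarrow> bool" where
  "unique_solution T \<iota> A B f g u0 u lam \<longleftrightarrow>
     solves_system T \<iota> A B f g u0 u lam \<and>
     (\<forall>u' lam'. solves_system T \<iota> A B f g u0 u' lam' \<longrightarrow>
        (\<forall>t\<in>{0..T}. u' t = u t) \<and> (AE t in lborel. t \<in> {0..T} \<longrightarrow> lam' t = lam t))"

subsection \<open>The deterministic scheme\<close>

definition step_size :: "real \<Rightarrow> real \<Rightarrow> bool" where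
  "step_size T \<tau> \<longleftrightarrow> (\<exists>N::nat. N \<ge> 1 \<and> \<tau> = T / real N)"

primrec det_scheme :: "(real \<Rightarrow> 'v \<Rightarrow> 'v) \<Rightarrow> real \<Rightarrow> 'v \<Rightarrow> nat \<Rightarrow> 'v" where
  "det_scheme \<psi> \<tau> x0 0 = x0"
| "det_scheme \<psi> \<tau> x0 (Suc n) = \<psi> (real n * \<tau>) (det_scheme \<psi> \<tau> x0 n)"

text \<open>\<open>\<Psi> \<tau> t v\<close> is the one-step map with step size \<open>\<tau>\<close>; \<open>W\<close> is the kernel of the constraint.\<close>

definition det_assumption ::
  "real \<Rightarrow> ('v::real_normed_vector \<Rightarrow>\<^sub>L 'h::real_normed_vector) \<Rightarrow> 'v set \<Rightarrow> (real \<Rightarrow> 'v) \<Rightarrow>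
   (real \<Rightarrow> real \<Rightarrow> 'v \<Rightarrow> 'v) \<Rightarrow> real \<Rightarrow> real \<Rightarrow> real \<Rightarrow> real \<Rightarrow> bool" where
  "det_assumption T \<iota> W uker \<Psi> \<tau>max C\<^sub>d q L\<^sub>\<Psi> \<longleftrightarrow>
     (\<forall>\<tau>. step_size T \<tau> \<and> \<tau> \<le> \<tau>max \<longrightarrow>
        (\<forall>t\<in>{0..T}. \<forall>v\<in>W. \<Psi> \<tau> t v \<in> W) \<and>
        (\<forall>n. real n * \<tau> \<le> T \<longrightarrow>
           norm (blinfun_apply \<iota> (uker (real n * \<tau>) - det_scheme (\<Psi> \<tau>) \<tau> (uker 0) n))
             \<le> C\<^sub>d * \<tau> powr q) \<and>
        (\<forall>t\<in>{0..T}. \<forall>v1\<in>W. \<forall>v2\<in>W.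
           norm (blinfun_apply \<iota> (\<Psi> \<tau> t v1 - \<Psi> \<tau> t v2))
             \<le> (1 + L\<^sub>\<Psi> * \<tau>) * norm (blinfun_apply \<iota> (v1 - v2))))"

subsection \<open>Gaussian noise\<close>

text \<open>The centered normal distribution with variance \<open>s\<^sup>2\<close>, degenerate for \<open>s = 0\<close>.\<close>

definition centered_normal :: "real \<Rightarrow> real measure" where
  "centered_normal s =
     (if s = 0 then return borel 0 else density lborel (\<lambda>x. ennreal (normal_density 0 s x)))"

text \<open>
  Measurability of functions with values in a Banach space: on separable spaces this is Borel
  measurability, in general the range has to be separable as well.
\<close>

definition strongly_measurable :: "'a measure \<Rightarrow> ('a \<Rightarrow> 'x::metric_space) \<Rightarrow> bool" where
  "strongly_measurable M X \<longleftrightarrow>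
     X \<in> borel_measurable M \<and> (\<exists>D. countable D \<and> X ` space M \<subseteq> closure D)"

text \<open>Every finite linear combination of scalar observations of the process is centered normal.\<close>

definition centered_gaussian_process ::
  "'w measure \<Rightarrow> real set \<Rightarrow> (real \<Rightarrow> 'w \<Rightarrow> 'v::real_normed_vector) \<Rightarrow> bool" where
  "centered_gaussian_process M I X \<longleftrightarrow>
     (\<forall>s\<in>I. X s \<in> borel_measurable M) \<and>
     (\<forall>S (\<phi> :: real \<Rightarrow> 'v \<Rightarrow>\<^sub>L real). finite S \<and> S \<subseteq> I \<longrightarrow>
        (\<exists>r. distr M borel (\<lambda>\<omega>. \<Sum>s\<in>S. blinfun_apply (\<phi> s) (X s \<omega>)) = centered_normal r))"

text \<open>
  A covariance on V, as a symmetric positive semidefinite bounded bilinear form on the dual of V.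
\<close>

definition covariance_form ::
  "(('v::real_normed_vector \<Rightarrow>\<^sub>L real) \<Rightarrow>\<^sub>L ('v \<Rightarrow>\<^sub>L real) \<Rightarrow>\<^sub>L real) \<Rightarrow> bool" where
  "covariance_form K \<longleftrightarrow>
     (\<forall>\<phi> \<theta>. blinfun_apply (blinfun_apply K \<phi>) \<theta> = blinfun_apply (blinfun_apply K \<theta>) \<phi>) \<and>
     (\<forall>\<phi>. blinfun_apply (blinfun_apply K \<phi>) \<phi> \<ge> 0)"

text \<open>
  The law \<open>N(0, \<sigma>\<^sup>2)\<close> on V, relative to a unit covariance \<open>K\<close>: the centered Gaussian law with
  covariance \<open>\<sigma>\<^sup>2 K\<close>. The identity is admissible as \<open>K\<close> in finite dimension only (in infinite
  dimension no Gaussian random variable has covariance \<open>\<sigma>\<^sup>2\<close> times the identity).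
\<close>

definition normal_law ::
  "'w measure \<Rightarrow> ('w \<Rightarrow> 'v::real_normed_vector) \<Rightarrow> real \<Rightarrow>
   (('v \<Rightarrow>\<^sub>L real) \<Rightarrow>\<^sub>L ('v \<Rightarrow>\<^sub>L real) \<Rightarrow>\<^sub>L real) \<Rightarrow> bool" where
  "normal_law M X \<sigma> K \<longleftrightarrow>
     (\<forall>\<phi>. distr M borel (\<lambda>\<omega>. blinfun_apply \<phi> (X \<omega>))
            = centered_normal (\<sigma> * sqrt (blinfun_apply (blinfun_apply K \<phi>) \<phi>)))"

definition path_on :: "real set \<Rightarrow> (real \<Rightarrow> 'w \<Rightarrow> 'v) \<Rightarrow> 'w \<Rightarrow> real \<Rightarrow> 'v" where
  "path_on I X \<omega> = (\<lambda>s\<in>I. X s \<omega>)"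

definition noise_integral ::
  "(nat \<Rightarrow> real \<Rightarrow> 'w \<Rightarrow> 'v::real_normed_vector) \<Rightarrow> nat \<Rightarrow> real \<Rightarrow> 'w \<Rightarrow> 'v" where
  "noise_integral \<eta> n t \<omega> = integral {0..t} (\<lambda>s. \<eta> n s \<omega>)"

text \<open>
  The noise for a single step size \<open>\<tau>\<close>; \<open>\<eta> n\<close> is the process of step \<open>n\<close>, on the time interval
  from 0 to \<open>\<tau>\<close>. Independence and identical distribution over \<open>n\<close> are those of the whole paths,
  as random elements of the product space. The last but one condition makes the pathwise integral
  defining \<open>noise_integral\<close> meaningful and measurable.
\<close>

definition noise_assumption ::
  "'w measure \<Rightarrow> ('v::real_normed_vector \<Rightarrow>\<^sub>L 'h::real_normed_vector) \<Rightarrow> 'v set \<Rightarrow> real \<Rightarrow>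
   (nat \<Rightarrow> real \<Rightarrow> 'w \<Rightarrow> 'v) \<Rightarrow> real \<Rightarrow> (('v \<Rightarrow>\<^sub>L real) \<Rightarrow>\<^sub>L ('v \<Rightarrow>\<^sub>L real) \<Rightarrow>\<^sub>L real) \<Rightarrow>
   real \<Rightarrow> real \<Rightarrow> bool" where
  "noise_assumption M \<iota> W \<tau> \<eta> \<sigma> K C\<^sub>\<xi> p \<longleftrightarrow>
     (\<forall>n. \<forall>s\<in>{0..\<tau>}. \<forall>\<omega>\<in>space M. \<eta> n s \<omega> \<in> W) \<and>
     (\<forall>n. centered_gaussian_process M {0..\<tau>} (\<eta> n)) \<and>
     (\<forall>n. \<forall>s\<in>{0..\<tau>}. normal_law M (\<eta> n s) \<sigma> K) \<and>
     prob_space.indep_vars M (\<lambda>_. \<Pi>\<^sub>M s\<in>{0..\<tau>}. borel) (\<lambda>n. path_on {0..\<tau>} (\<eta> n)) UNIV \<and>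
     (\<forall>m n. distr M (\<Pi>\<^sub>M s\<in>{0..\<tau>}. borel) (path_on {0..\<tau>} (\<eta> m))
          = distr M (\<Pi>\<^sub>M s\<in>{0..\<tau>}. borel) (path_on {0..\<tau>} (\<eta> n))) \<and>
     (\<forall>n. strongly_measurable (restrict_space borel {0..\<tau>} \<Otimes>\<^sub>M M) (\<lambda>(s, \<omega>). \<eta> n s \<omega>) \<and>
        (\<forall>\<omega>\<in>space M. (\<lambda>s. \<eta> n s \<omega>) integrable_on {0..\<tau>} \<and>
                     (\<lambda>s. norm (\<eta> n s \<omega>)) integrable_on {0..\<tau>})) \<and>
     (\<forall>n. \<forall>t\<in>{0..\<tau>}.
        integrable M (\<lambda>\<omega>. (norm (blinfun_apply \<iota> (noise_integral \<eta> n t \<omega>)))\<^sup>2) \<and>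
        (LINT \<omega>|M. (norm (blinfun_apply \<iota> (noise_integral \<eta> n t \<omega>)))\<^sup>2) \<le> C\<^sub>\<xi> * t powr (2 * p + 1))"

subsection \<open>The probabilistic scheme\<close>

primrec prob_scheme_ker ::
  "(real \<Rightarrow> 'v \<Rightarrow> 'v) \<Rightarrow> real \<Rightarrow> (nat \<Rightarrow> real \<Rightarrow> 'w \<Rightarrow> 'v::real_normed_vector) \<Rightarrow> 'v \<Rightarrow>
   nat \<Rightarrow> 'w \<Rightarrow> 'v" where
  "prob_scheme_ker \<psi> \<tau> \<eta> x0 0 \<omega> = x0"
| "prob_scheme_ker \<psi> \<tau> \<eta> x0 (Suc n) \<omega> =
     \<psi> (real n * \<tau>) (prob_scheme_ker \<psi> \<tau> \<eta> x0 n \<omega>) + noise_integral \<eta> n \<tau> \<omega>"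

definition prob_scheme ::
  "(real \<Rightarrow> 'v \<Rightarrow> 'v) \<Rightarrow> real \<Rightarrow> (nat \<Rightarrow> real \<Rightarrow> 'w \<Rightarrow> 'v::real_normed_vector) \<Rightarrow> 'v \<Rightarrow>
   (('q::real_normed_vector \<Rightarrow>\<^sub>L real) \<Rightarrow>\<^sub>L 'v) \<Rightarrow> (real \<Rightarrow> ('q \<Rightarrow>\<^sub>L real)) \<Rightarrow> nat \<Rightarrow> 'w \<Rightarrow> 'v" where
  "prob_scheme \<psi> \<tau> \<eta> x0 Bm g n \<omega> =
     prob_scheme_ker \<psi> \<tau> \<eta> x0 n \<omega> + blinfun_apply Bm (g (real n * \<tau>))"

end

theory Submission
  imports Defs
begin

text \<open>
  Since the probabilistic and the exact solution share the component \<open>Bm (g t)\<close>, the error lives in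
  the kernel of \<open>B\<close>. It is the sum of the error of the deterministic scheme, of order \<open>q\<close> by
  assumption, and of the deviation \<open>e n\<close> of the probabilistic from the deterministic scheme, both
  started at \<open>uker 0\<close>. The triangle inequality in mean square applied to the recursion of \<open>e\<close> would
  add up \<open>N\<close> perturbations of size \<open>\<tau> powr (p + 1/2)\<close> and so lose half an order. Instead one uses that
  the perturbation of step \<open>n\<close> is centered and independent of the first \<open>n\<close> steps: the mixed term of
  the square has expectation zero, and \<open>E (norm (e (n + 1)))\<^sup>2 \<le> (1 + L\<^sub>\<Psi> * \<tau>)\<^sup>2 * E (norm (e n))\<^sup>2 +
  C\<^sub>\<xi> * \<tau> powr (2 * p + 1)\<close>. After at most \<open>T / \<tau>\<close> steps a discrete Gronwall argument gives
  \<open>E (norm (e n))\<^sup>2 \<le> T * C\<^sub>\<xi> * exp (2 * L\<^sub>\<Psi> * T) * \<tau> powr (2 * p)\<close>. This recursion is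
  \<open>mean_square_perturbation\<close>.

  The work lies in the mixed term. The spaces may be non-separable, so that all measurability is
  obtained from scalar observations together with separability of the range
  (\<open>pettis_measurability\<close>). The mixed term is reduced to the scalar statements
  \<open>E (1\<^sub>A * \<langle>h, \<xi>\<rangle>) = 0\<close> for events \<open>A\<close> of the past (\<open>orthogonal_if_uncorrelated_on_events\<close>).

  Independence is known for the paths of the processes, as elements of an uncountable product
  space, and a time integral need not be a measurable function of the path in that sense. It is one
  up to a null set: a jointly measurable process whose values at all fixed times are measurable for a
  sub-algebra has a time integral that agrees almost everywhere with its conditional expectation
  (\<open>process_integral_ae_measurable\<close>). Hence the past is described by the path algebra with the null
  events added (\<open>ae_completion\<close>), and by Fubini only the observations of the noise at single times,
  which are functions of the path, have to be independent of it
  (\<open>noise_integral_uncorrelated_past\<close>).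
\<close>

section \<open>Separably valued functions and measurability\<close>

lemma limit_in_closure:
  fixes l :: "'a::first_countable_topology"
  assumes "\<And>n. x n \<in> S" and "x \<longlonglongrightarrow> l"
  shows "l \<in> closure S"
  unfolding closure_sequential by (rule exI[of _ x]) (simp add: assms)

lemma closure_limit_ex:
  fixes l :: "'a::first_countable_topology"
  assumes "l \<in> closure S"
  obtains x where "\<And>n. x n \<in> S" and "x \<longlonglongrightarrow> l"
  using assms unfolding closure_sequential by metis

text \<open>
  Linear combinations with rational coefficients are countable in number and dense in the span.
\<close>

lemma countable_dense_in_span:
  fixes D :: "'a::real_normed_vector set"
  assumes "countable D"
  obtains E where "countable E" "E \<subseteq> span D" "span D \<subseteq> closure E"
proof
  define comb :: "(rat \<times> 'a) list \<Rightarrow> 'a"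
    where "comb xs = (\<Sum>(r, a)\<leftarrow>xs. of_rat r *\<^sub>R a)" for xs
  let ?E = "comb ` lists (UNIV \<times> D)"
  show "countable ?E" using assms by (intro countable_image countable_lists) auto
  have "comb xs \<in> span D" if "xs \<in> lists (UNIV \<times> D)" for xs
    using that
  proof (induction xs)
    case Nil
    then show ?case by (simp add: comb_def span_zero)
  next
    case (Cons x xs)
    then show ?case by (cases x) (simp add: comb_def span_add span_scale span_base)
  qed
  then show "?E \<subseteq> span D" by blast
  show "span D \<subseteq> closure ?E"
  proof
    fix x assume "x \<in> span D"
    then show "x \<in> closure ?E"
    proof (induction rule: span_induct_alt)
      case base
      have "comb [] = 0" by (simp add: comb_def)
      then have "0 \<in> ?E" by (intro image_eqI[of _ _ "[]"]) simp_all
      then show ?case by (rule subsetD[OF closure_subset])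
    next
      case (step c a y)
      obtain e where e: "\<And>n. e n \<in> ?E" "e \<longlonglongrightarrow> y"
        by (rule closure_limit_ex[OF step.IH]) (rule that)
      have "\<exists>q::rat. \<bar>of_rat q - c\<bar> < 1 / Suc n" for n
      proof -
        obtain q where "c - 1 / Suc n < of_rat q" "of_rat q < c + 1 / Suc n"
          using of_rat_dense[of "c - 1 / Suc n" "c + 1 / Suc n"] by auto
        then show ?thesis by (intro exI[of _ q]) linarith
      qed
      then obtain q :: "nat \<Rightarrow> rat" where q: "\<And>n. \<bar>of_rat (q n) - c\<bar> < 1 / Suc n" by metis
      have "(\<lambda>n. of_rat (q n) - c) \<longlonglongrightarrow> 0"
        by (rule Lim_null_comparison[OF _ LIMSEQ_inverse_real_of_nat])
           (use q in \<open>auto intro!: always_eventually less_imp_le simp: inverse_eq_divide\<close>)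
      then have "(\<lambda>n. of_rat (q n)) \<longlonglongrightarrow> c" by (simp add: LIM_zero_iff)
      then have "(\<lambda>n. of_rat (q n) *\<^sub>R a + e n) \<longlonglongrightarrow> c *\<^sub>R a + y"
        by (intro tendsto_intros e)
      moreover have "of_rat (q n) *\<^sub>R a + e n \<in> ?E" for n
      proof -
        obtain xs where xs: "xs \<in> lists (UNIV \<times> D)" "e n = comb xs" using e(1) by blast
        have "of_rat (q n) *\<^sub>R a + e n = comb ((q n, a) # xs)" by (simp add: comb_def xs)
        then show ?thesis using xs(1) step.hyps by (intro image_eqI[of _ _ "(q n, a) # xs"]) auto
      qed
      ultimately show ?case by (rule limit_in_closure[rotated 1])
    qed
  qed
qed

text \<open>
  The points of \<open>D\<close> may lie outside \<open>A\<close>; near each of them, and for each radius \<open>1 / (k + 1)\<close>, one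
  point of \<open>A\<close> is picked whenever there is one.
\<close>

lemma subset_of_separable:
  fixes A D :: "'a::metric_space set"
  assumes "countable D" "A \<subseteq> closure D"
  obtains E where "countable E" "E \<subseteq> A" "A \<subseteq> closure E"
proof
  define pick where "pick d k = (SOME a. a \<in> A \<and> dist a d < 1 / Suc k)" for d and k :: nat
  let ?E = "{pick d k | d k. d \<in> D \<and> (\<exists>a\<in>A. dist a d < 1 / Suc k)}"
  have "?E \<subseteq> (\<lambda>(d, k). pick d k) ` (D \<times> UNIV)" by auto
  then show "countable ?E" by (rule countable_subset) (use assms(1) in auto)
  have pick: "pick d k \<in> A \<and> dist (pick d k) d < 1 / Suc k" if "\<exists>a\<in>A. dist a d < 1 / Suc k" for d k
    unfolding pick_def by (rule someI_ex) (use that in blast)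
  then show "?E \<subseteq> A" by auto
  show "A \<subseteq> closure ?E"
  proof
    fix a assume a: "a \<in> A"
    show "a \<in> closure ?E" unfolding closure_approachable
    proof safe
      fix e :: real assume "e > 0"
      then obtain k :: nat where k: "1 / Suc k < e / 2" using nat_approx_posE[of "e/2"] by auto
      have "a \<in> closure D" using a assms(2) by auto
      then obtain d where d: "d \<in> D" "dist d a < 1 / Suc k"
        unfolding closure_approachable by (metis of_nat_0_less_iff zero_less_Suc zero_less_divide_1_iff)
      have ex: "\<exists>a\<in>A. dist a d < 1 / Suc k" using a d by (auto simp: dist_commute)
      have "dist (pick d k) a \<le> dist (pick d k) d + dist d a" by (rule dist_triangle)
      then have "dist (pick d k) a < e" using pick[OF ex] d k by linarith
      then show "\<exists>y\<in>?E. dist y a < e" using d ex by blast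
    qed
  qed
qed

text \<open>
  Countably many scalar observations decide whether a point lies in a given ball. Density allows to
  test with \<open>e\<close> tending to \<open>x\<close> itself.
\<close>

lemma norm_le_iff_inner_dense:
  fixes x :: "'a::real_inner"
  assumes "x \<in> closure E" and "r \<ge> 0"
  shows "norm x \<le> r \<longleftrightarrow> (\<forall>e\<in>E. e \<bullet> x \<le> r * norm e)"
proof
  assume "norm x \<le> r"
  then show "\<forall>e\<in>E. e \<bullet> x \<le> r * norm e"
    by (metis mult.commute mult_right_mono norm_cauchy_schwarz norm_ge_zero order_trans)
next
  assume le: "\<forall>e\<in>E. e \<bullet> x \<le> r * norm e"
  obtain e where e: "\<And>n. e n \<in> E" "e \<longlonglongrightarrow> x" by (rule closure_limit_ex[OF assms(1)]) (rule that)
  have "x \<bullet> x \<le> r * norm x"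
    by (rule LIMSEQ_le[where X = "\<lambda>n. e n \<bullet> x" and Y = "\<lambda>n. r * norm (e n)"])
       (use le e in \<open>auto intro!: tendsto_intros\<close>)
  then have "norm x * norm x \<le> r * norm x" by (simp add: dot_square_norm power2_eq_square)
  then show "norm x \<le> r" using assms(2) by (cases "norm x = 0") auto
qed

text \<open>
  Preimages of closed balls are countable intersections of events of scalar observations, and within
  a separable range every open set is a countable union of such balls.
\<close>

lemma pettis_measurability:
  fixes X :: "'a \<Rightarrow> 'h::real_inner"
  assumes weak: "\<And>h. (\<lambda>\<omega>. h \<bullet> X \<omega>) \<in> borel_measurable M"
    and D: "countable D" "X ` space M \<subseteq> closure (span D)"
  shows "strongly_measurable M X"
proof -
  obtain E where E: "countable E" "E \<subseteq> span D" "span D \<subseteq> closure E"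
    using countable_dense_in_span[OF D(1)] by blast
  have "closure (span D) \<subseteq> closure E" using E(3) by (simp add: closure_minimal)
  have cl: "X \<omega> - e \<in> closure E" if "\<omega> \<in> space M" "e \<in> E" for \<omega> e
  proof -
    have "X \<omega> \<in> closure (span D)" using D(2) that(1) by blast
    then obtain x where x: "\<And>n. x n \<in> span D" "x \<longlonglongrightarrow> X \<omega>"
      by (rule closure_limit_ex) (rule that)
    have "(\<lambda>n. x n - e) \<longlonglongrightarrow> X \<omega> - e" by (intro tendsto_intros x)
    moreover have "x n - e \<in> span D" for n using x(1) E(2) that(2) by (auto intro: span_diff)
    ultimately have "X \<omega> - e \<in> closure (span D)" by (rule limit_in_closure[rotated 1])
    then show ?thesis using \<open>closure (span D) \<subseteq> closure E\<close> by blast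
  qed
  have ball: "X -` cball e r \<inter> space M \<in> sets M" if "e \<in> E" "r \<ge> 0" for e r
  proof -
    have "X -` cball e r \<inter> space M
        = {\<omega>\<in>space M. \<forall>d\<in>E. d \<bullet> X \<omega> - d \<bullet> e \<le> r * norm d}"
    proof -
      have "X \<omega> \<in> cball e r \<longleftrightarrow> (\<forall>d\<in>E. d \<bullet> X \<omega> - d \<bullet> e \<le> r * norm d)" if "\<omega> \<in> space M" for \<omega>
        using norm_le_iff_inner_dense[OF cl[OF that \<open>e \<in> E\<close>] \<open>r \<ge> 0\<close>]
        by (simp add: dist_norm norm_minus_commute[of e] inner_diff_right)
      then show ?thesis by auto
    qed
    also have "\<dots> \<in> sets M"
    proof (rule sets.sets_Collect_countable_All'[OF _ E(1)])
      fix d note [measurable] = weak[of d]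
      show "{\<omega> \<in> space M. d \<bullet> X \<omega> - d \<bullet> e \<le> r * norm d} \<in> sets M" by measurable
    qed
    finally show ?thesis .
  qed
  have "X \<in> borel_measurable M"
  proof (rule borel_measurableI)
    fix U :: "'h set" assume "open U"
    let ?I = "{(e, r). e \<in> E \<and> r \<in> \<rat> \<and> 0 \<le> r \<and> cball e r \<subseteq> U}"
    have "X -` U \<inter> space M = (\<Union>(e, r)\<in>?I. X -` cball e r \<inter> space M)"
    proof (intro equalityI subsetI)
      fix \<omega> assume w: "\<omega> \<in> X -` U \<inter> space M"
      then obtain s where s: "s > 0" "ball (X \<omega>) s \<subseteq> U" using \<open>open U\<close> open_contains_ball by blast
      obtain r where r: "r \<in> \<rat>" "0 < r" "r < s / 2"
        using Rats_dense_in_real[of 0 "s/2"] s by auto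
      have "X \<omega> \<in> closure E" using w D(2) \<open>closure (span D) \<subseteq> closure E\<close> by auto
      then obtain e where e: "e \<in> E" "dist e (X \<omega>) < r"
        using r unfolding closure_approachable by auto
      have "cball e r \<subseteq> U"
      proof
        fix y assume "y \<in> cball e r"
        then have "dist (X \<omega>) y < s"
          using dist_triangle[of "X \<omega>" y e] e(2) r by (simp add: dist_commute)
        then show "y \<in> U" using s by auto
      qed
      then show "\<omega> \<in> (\<Union>(e, r)\<in>?I. X -` cball e r \<inter> space M)" using e r w by force
    qed auto
    also have "\<dots> \<in> sets M"
    proof (rule sets.countable_UN')
      have "?I \<subseteq> E \<times> \<rat>" by auto
      then show "countable ?I" using E(1) countable_rat by (meson countable_SIGMA countable_subset)
    qed (use ball in auto)
    finally show "X -` U \<inter> space M \<in> sets M" .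
  qed
  moreover have "X ` space M \<subseteq> closure E" using D(2) \<open>closure (span D) \<subseteq> closure E\<close> by auto
  ultimately show ?thesis unfolding strongly_measurable_def using E(1) by blast
qed

lemma measurable_inner_strongly:
  fixes X :: "'a \<Rightarrow> 'h::real_inner"
  assumes "strongly_measurable M X"
  shows "(\<lambda>\<omega>. h \<bullet> X \<omega>) \<in> borel_measurable M"
proof -
  have X: "X \<in> borel_measurable M" using assms unfolding strongly_measurable_def by simp
  have "(\<lambda>x. h \<bullet> x) \<in> borel_measurable borel"
    by (intro borel_measurable_continuous_onI continuous_intros)
  from measurable_compose[OF X this] show ?thesis .
qed

text \<open>
  For non-separable values, Borel measurability alone is not preserved by sums; with separable ranges
  it follows from that of the scalar observations.
\<close>

lemma strongly_measurable_add:
  fixes X Y :: "'a \<Rightarrow> 'h::real_inner"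
  assumes "strongly_measurable M X" "strongly_measurable M Y"
  shows "strongly_measurable M (\<lambda>\<omega>. X \<omega> + Y \<omega>)"
proof -
  obtain D E where D: "countable D" "X ` space M \<subseteq> closure D" and E: "countable E" "Y ` space M \<subseteq> closure E"
    using assms unfolding strongly_measurable_def by blast
  show ?thesis
  proof (rule pettis_measurability)
    fix h
    have [measurable]: "(\<lambda>\<omega>. h \<bullet> X \<omega>) \<in> borel_measurable M" "(\<lambda>\<omega>. h \<bullet> Y \<omega>) \<in> borel_measurable M"
      by (rule measurable_inner_strongly, rule assms)+
    show "(\<lambda>\<omega>. h \<bullet> (X \<omega> + Y \<omega>)) \<in> borel_measurable M" by (simp add: inner_add_right)
  next
    show "countable (D \<union> E)" using D E by auto
    show "(\<lambda>\<omega>. X \<omega> + Y \<omega>) ` space M \<subseteq> closure (span (D \<union> E))"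
    proof safe
      fix \<omega> assume w: "\<omega> \<in> space M"
      have X: "X \<omega> \<in> closure D" and Y: "Y \<omega> \<in> closure E" using D(2) E(2) w by blast+
      obtain x where x: "\<And>n. x n \<in> D" "x \<longlonglongrightarrow> X \<omega>" by (rule closure_limit_ex[OF X]) (rule that)
      obtain y where y: "\<And>n. y n \<in> E" "y \<longlonglongrightarrow> Y \<omega>" by (rule closure_limit_ex[OF Y]) (rule that)
      note xy = x y
      then have "(\<lambda>n. x n + y n) \<longlonglongrightarrow> X \<omega> + Y \<omega>" by (intro tendsto_add)
      moreover have "x n + y n \<in> span (D \<union> E)" for n using xy by (simp add: span_add span_base)
      ultimately show "X \<omega> + Y \<omega> \<in> closure (span (D \<union> E))" by (rule limit_in_closure[rotated 1])
    qed
  qed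
qed

text \<open>
  Continuity is asked for on a set containing the values only, because the one-step maps are Lipschitz
  on the image of the constraint kernel only. For the same reason the countable dense set is taken
  among the values of \<open>X\<close>.
\<close>

lemma strongly_measurable_compose:
  fixes X :: "'a \<Rightarrow> 'b::metric_space" and \<Phi> :: "'b \<Rightarrow> 'c::metric_space"
  assumes X: "strongly_measurable M X" "X ` space M \<subseteq> S" and \<Phi>: "continuous_on S \<Phi>"
  shows "strongly_measurable M (\<lambda>\<omega>. \<Phi> (X \<omega>))"
proof -
  obtain D where D: "countable D" "X ` space M \<subseteq> closure D"
    using X unfolding strongly_measurable_def by blast
  then obtain E where E: "countable E" "E \<subseteq> X ` space M" "X ` space M \<subseteq> closure E"
    using subset_of_separable by blast
  have "X \<in> measurable M (restrict_space borel S)"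
    using X unfolding strongly_measurable_def by (auto intro!: measurable_restrict_space2)
  then have "(\<lambda>\<omega>. \<Phi> (X \<omega>)) \<in> borel_measurable M"
    using borel_measurable_continuous_on_restrict[OF \<Phi>] by (rule measurable_compose)
  moreover have "(\<lambda>\<omega>. \<Phi> (X \<omega>)) ` space M \<subseteq> closure (\<Phi> ` E)"
  proof safe
    fix \<omega> assume w: "\<omega> \<in> space M"
    then have "X \<omega> \<in> closure E" using E(3) by blast
    then obtain x where x: "\<And>n. x n \<in> E" "x \<longlonglongrightarrow> X \<omega>" by (rule closure_limit_ex) (rule that)
    have "(\<lambda>n. \<Phi> (x n)) \<longlonglongrightarrow> \<Phi> (X \<omega>)"
      by (rule continuous_on_tendsto_compose[OF \<Phi> x(2)])
         (use x(1) E(2) X(2) w in \<open>auto intro!: always_eventually\<close>)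
    then show "\<Phi> (X \<omega>) \<in> closure (\<Phi> ` E)" by (intro limit_in_closure[of "\<lambda>n. \<Phi> (x n)"]) (use x(1) in auto)
  qed
  ultimately show ?thesis unfolding strongly_measurable_def using E(1) by blast
qed

lemma strongly_measurable_subalgebra:
  "subalgebra M F \<Longrightarrow> strongly_measurable F X \<Longrightarrow> strongly_measurable M X"
  unfolding strongly_measurable_def subalgebra_def
  by (metis measurable_from_subalg subalgebra_def)

lemma strongly_measurable_const: "strongly_measurable M (\<lambda>_. c)"
  unfolding strongly_measurable_def by (auto intro!: exI[of _ "{c}"])

section \<open>Orthogonality to the past\<close>

text \<open>
  A separably valued \<open>Y\<close> is the pointwise limit of functions \<open>S k\<close> with finitely many values, each taken
  on an event of \<open>G\<close>, and for these the claim is a finite sum of the hypothesis. The value of \<open>S k\<close> is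
  the nearest to \<open>Y\<close> among \<open>0\<close> and the first \<open>k\<close> points of a dense sequence; the competitor \<open>0\<close> keeps
  \<open>S k\<close> below \<open>2 * norm Y\<close>, which permits dominated convergence.
\<close>

lemma orthogonal_if_uncorrelated_on_events:
  fixes Y Z :: "'w \<Rightarrow> 'h::real_inner"
  assumes "finite_measure M" and sub: "subalgebra M G" and Y: "strongly_measurable G Y"
    and Z [measurable]: "\<And>h. (\<lambda>\<omega>. h \<bullet> Z \<omega>) \<in> borel_measurable M"
    and Y2: "integrable M (\<lambda>\<omega>. (norm (Y \<omega>))\<^sup>2)" and Z2: "integrable M (\<lambda>\<omega>. (norm (Z \<omega>))\<^sup>2)"
    and unc: "\<And>h A. A \<in> sets G \<Longrightarrow> (LINT \<omega>|M. indicator A \<omega> * (h \<bullet> Z \<omega>)) = 0"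
  shows "integrable M (\<lambda>\<omega>. Y \<omega> \<bullet> Z \<omega>)" and "(LINT \<omega>|M. Y \<omega> \<bullet> Z \<omega>) = 0"
proof -
  interpret finite_measure M by fact
  have sp: "space G = space M" and GM: "\<And>A. A \<in> sets G \<Longrightarrow> A \<in> sets M"
    using sub unfolding subalgebra_def by auto
  have [measurable]: "Y \<in> borel_measurable G" using Y unfolding strongly_measurable_def by auto
  obtain D where D: "countable D" "Y ` space M \<subseteq> closure D"
    using Y unfolding strongly_measurable_def sp by auto
  define d where "d = from_nat_into (insert 0 D)"
  have ran: "range d = insert 0 D" unfolding d_def using D(1) by (intro range_from_nat_into) auto
  define S where "S \<omega> = rec_nat 0 (\<lambda>k s. if dist (Y \<omega>) (d k) < dist (Y \<omega>) s then d k else s)" for \<omega>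
  have S0: "S \<omega> 0 = 0"
    and SS: "S \<omega> (Suc k) = (if dist (Y \<omega>) (d k) < dist (Y \<omega>) (S \<omega> k) then d k else S \<omega> k)" for \<omega> k
    by (simp_all add: S_def)
  have distS: "dist (Y \<omega>) (S \<omega> (Suc k)) = min (dist (Y \<omega>) (d k)) (dist (Y \<omega>) (S \<omega> k))" for \<omega> k
    by (auto simp: SS)
  have distS_le: "dist (Y \<omega>) (S \<omega> k) \<le> norm (Y \<omega>)" for \<omega> k
    by (induction k) (auto simp: S0 distS)
  have distS_le': "dist (Y \<omega>) (S \<omega> k) \<le> dist (Y \<omega>) (d i)" if "i < k" for \<omega> k i
    using that by (induction k) (auto simp: distS less_Suc_eq)
  have Sconv: "(\<lambda>k. S \<omega> k) \<longlonglongrightarrow> Y \<omega>" if "\<omega> \<in> space M" for \<omega>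
  proof (rule metric_LIMSEQ_I)
    fix e :: real assume "e > 0"
    moreover have "Y \<omega> \<in> closure D" using D(2) that by auto
    ultimately obtain y where "y \<in> D" "dist y (Y \<omega>) < e" unfolding closure_approachable by blast
    moreover then obtain i where "y = d i" using ran by (metis insertCI rangeE)
    ultimately have "dist (S \<omega> k) (Y \<omega>) < e" if "k \<ge> Suc i" for k
      using distS_le'[of i k \<omega>] that by (simp add: dist_commute)
    then show "\<exists>no. \<forall>n\<ge>no. dist (S \<omega> n) (Y \<omega>) < e" by blast
  qed
  have dist_meas: "(\<lambda>\<omega>. dist (Y \<omega>) c) \<in> borel_measurable G" for c
  proof -
    have "(\<lambda>y. dist y c) \<in> borel_measurable borel"
      by (intro borel_measurable_continuous_onI continuous_intros)
    then show ?thesis by (rule measurable_compose[rotated]) measurable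
  qed
  have distS_meas: "(\<lambda>\<omega>. dist (Y \<omega>) (S \<omega> k)) \<in> borel_measurable G" for k
  proof (induction k)
    case 0 show ?case using dist_meas[of 0] by (simp add: S0)
  next
    case (Suc k)
    note [measurable] = Suc dist_meas[of "d k"]
    show ?case unfolding distS by measurable
  qed
  have normZ: "integrable M (\<lambda>\<omega>. norm (Z \<omega>))"
  proof -
    have "(\<lambda>\<omega>. sqrt ((norm (Z \<omega>))\<^sup>2)) \<in> borel_measurable M"
      using borel_measurable_integrable[OF Z2] by measurable
    then have [measurable]: "(\<lambda>\<omega>. norm (Z \<omega>)) \<in> borel_measurable M" by simp
    show ?thesis
    proof (rule Bochner_Integration.integrable_bound)
      show "integrable M (\<lambda>\<omega>. 1 + (norm (Z \<omega>))\<^sup>2)" using Z2 by simp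
      have "norm z \<le> 1 + (norm z)\<^sup>2" for z :: 'h
        using sum_squares_bound[of 1 "norm z"] by (simp add: power2_eq_square) (smt (verit) norm_ge_zero)
      then show "AE \<omega> in M. norm (norm (Z \<omega>)) \<le> norm (1 + (norm (Z \<omega>))\<^sup>2)" by simp
    qed measurable
  qed
  have int_h: "integrable M (\<lambda>\<omega>. indicator A \<omega> * (h \<bullet> Z \<omega>))" if "A \<in> sets G" for A h
  proof (rule Bochner_Integration.integrable_bound)
    show "(\<lambda>\<omega>. indicator A \<omega> * (h \<bullet> Z \<omega>)) \<in> borel_measurable M"
      by (intro borel_measurable_times borel_measurable_indicator GM that Z)
    show "integrable M (\<lambda>\<omega>. norm h * norm (Z \<omega>))" using normZ by simp
    show "AE \<omega> in M. norm (indicator A \<omega> * (h \<bullet> Z \<omega>)) \<le> norm (norm h * norm (Z \<omega>))"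
      by (auto simp: indicator_def Cauchy_Schwarz_ineq2)
  qed
  have simple: "integrable M (\<lambda>\<omega>. indicator A \<omega> * (S \<omega> k \<bullet> Z \<omega>)) \<and>
      (LINT \<omega>|M. indicator A \<omega> * (S \<omega> k \<bullet> Z \<omega>)) = 0" if "A \<in> sets G" for A k
    using that
  proof (induction k arbitrary: A)
    case 0 show ?case by (simp add: S0)
  next
    case (Suc k)
    define B where "B = {\<omega>\<in>space G. dist (Y \<omega>) (d k) < dist (Y \<omega>) (S \<omega> k)}"
    note [measurable] = dist_meas[of "d k"] distS_meas[of k]
    have "B \<in> sets G" unfolding B_def by measurable
    then have AB: "A \<inter> B \<in> sets G" "A - B \<in> sets G" using Suc.prems by auto
    have eq: "indicator A \<omega> * (S \<omega> (Suc k) \<bullet> Z \<omega>)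
        = indicator (A \<inter> B) \<omega> * (d k \<bullet> Z \<omega>) + indicator (A - B) \<omega> * (S \<omega> k \<bullet> Z \<omega>)"
      if "\<omega> \<in> space M" for \<omega>
      using that by (auto simp: SS B_def sp indicator_def)
    note int1 = int_h[OF AB(1), of "d k"] and int2 = Suc.IH[OF AB(2)]
    show ?case
      using int1 int2 unc[OF AB(1), of "d k"]
      by (simp add: eq cong: Bochner_Integration.integrable_cong Bochner_Integration.integral_cong)
  qed
  have S_int: "integrable M (\<lambda>\<omega>. S \<omega> k \<bullet> Z \<omega>)" and S_zero: "(LINT \<omega>|M. S \<omega> k \<bullet> Z \<omega>) = 0" for k
    using simple[OF sets.top[of G], of k] unfolding sp
    by (simp_all cong: Bochner_Integration.integrable_cong Bochner_Integration.integral_cong)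
  have conv: "(\<lambda>k. S \<omega> k \<bullet> Z \<omega>) \<longlonglongrightarrow> Y \<omega> \<bullet> Z \<omega>" if "\<omega> \<in> space M" for \<omega>
    by (intro tendsto_intros Sconv that)
  have meas: "(\<lambda>\<omega>. Y \<omega> \<bullet> Z \<omega>) \<in> borel_measurable M"
    by (rule borel_measurable_LIMSEQ_real[OF conv]) (use S_int in auto)
  have dom: "\<bar>S \<omega> k \<bullet> Z \<omega>\<bar> \<le> (norm (Y \<omega>))\<^sup>2 + (norm (Z \<omega>))\<^sup>2" for \<omega> k
  proof -
    have "norm (S \<omega> k) \<le> 2 * norm (Y \<omega>)"
      using distS_le[of \<omega> k] norm_triangle_ineq2[of "S \<omega> k" "Y \<omega>"]
      by (simp add: dist_norm norm_minus_commute)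
    then have "norm (S \<omega> k) * norm (Z \<omega>) \<le> 2 * norm (Y \<omega>) * norm (Z \<omega>)" by (intro mult_right_mono) auto
    also have "\<dots> \<le> (norm (Y \<omega>))\<^sup>2 + (norm (Z \<omega>))\<^sup>2" by (rule sum_squares_bound)
    finally show ?thesis using Cauchy_Schwarz_ineq2[of "S \<omega> k" "Z \<omega>"] by linarith
  qed
  have bnd: "integrable M (\<lambda>\<omega>. (norm (Y \<omega>))\<^sup>2 + (norm (Z \<omega>))\<^sup>2)" using Y2 Z2 by simp
  show "integrable M (\<lambda>\<omega>. Y \<omega> \<bullet> Z \<omega>)"
    by (rule integrable_dominated_convergence[OF meas _ bnd, of "\<lambda>k \<omega>. S \<omega> k \<bullet> Z \<omega>"])
       (use S_int conv dom in auto)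
  have "(\<lambda>k. LINT \<omega>|M. S \<omega> k \<bullet> Z \<omega>) \<longlonglongrightarrow> (LINT \<omega>|M. Y \<omega> \<bullet> Z \<omega>)"
    by (rule integral_dominated_convergence[OF meas _ bnd]) (use S_int conv dom in auto)
  then show "(LINT \<omega>|M. Y \<omega> \<bullet> Z \<omega>) = 0" unfolding S_zero by (simp add: LIMSEQ_const_iff)
qed


section \<open>Completed sub-algebras and integrals of processes\<close>

text \<open>
  The events of \<open>M\<close> that agree almost everywhere with an event of \<open>F\<close>. In contrast to the completion of
  a measure, this is a sub-algebra of \<open>M\<close>.
\<close>

definition ae_completion :: "'w measure \<Rightarrow> 'w measure \<Rightarrow> 'w measure" where
  "ae_completion M F =
     sigma (space M) {A \<in> sets M. \<exists>A'\<in>sets F. AE \<omega> in M. \<omega> \<in> A \<longleftrightarrow> \<omega> \<in> A'}"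

lemma space_ae_completion [simp]: "space (ae_completion M F) = space M"
  unfolding ae_completion_def by (auto simp: space_measure_of_conv)

lemma sets_ae_completion:
  assumes "subalgebra M F"
  shows "sets (ae_completion M F) = {A \<in> sets M. \<exists>A'\<in>sets F. AE \<omega> in M. \<omega> \<in> A \<longleftrightarrow> \<omega> \<in> A'}" (is "_ = ?S")
proof -
  have sp: "space F = space M" using assms unfolding subalgebra_def by auto
  have "sigma_algebra (space M) ?S"
    unfolding sigma_algebra_iff2
  proof (intro conjI ballI allI impI)
    show "?S \<subseteq> Pow (space M)" using sets.sets_into_space by auto
    show "{} \<in> ?S" by (auto intro!: bexI[of _ "{}"])
  next
    fix A assume "A \<in> ?S"
    then obtain A' where A: "A \<in> sets M" "A' \<in> sets F" "AE \<omega> in M. \<omega> \<in> A \<longleftrightarrow> \<omega> \<in> A'" by auto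
    have "AE \<omega> in M. \<omega> \<in> space M - A \<longleftrightarrow> \<omega> \<in> space M - A'" using A(3) by eventually_elim auto
    moreover have "space M - A' \<in> sets F" using sets.compl_sets[OF A(2)] unfolding sp .
    ultimately show "space M - A \<in> ?S" using sets.compl_sets[OF A(1)] by blast
  next
    fix A :: "nat \<Rightarrow> _" assume "range A \<subseteq> ?S"
    then have "\<forall>i. \<exists>A'. A i \<in> sets M \<and> A' \<in> sets F \<and> (AE \<omega> in M. \<omega> \<in> A i \<longleftrightarrow> \<omega> \<in> A')" by blast
    then obtain A' where A: "\<And>i. A i \<in> sets M" "\<And>i. A' i \<in> sets F"
        "\<And>i. AE \<omega> in M. \<omega> \<in> A i \<longleftrightarrow> \<omega> \<in> A' i" by metis
    have "AE \<omega> in M. \<forall>i. \<omega> \<in> A i \<longleftrightarrow> \<omega> \<in> A' i" using A(3) by (simp add: AE_all_countable)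
    then have "AE \<omega> in M. \<omega> \<in> (\<Union>i. A i) \<longleftrightarrow> \<omega> \<in> (\<Union>i. A' i)" by eventually_elim auto
    moreover have "(\<Union>i. A i) \<in> sets M" "(\<Union>i. A' i) \<in> sets F" using A by auto
    ultimately show "(\<Union>i. A i) \<in> ?S" by blast
  qed
  then interpret S: sigma_algebra "space M" ?S .
  show ?thesis
    unfolding ae_completion_def using S.space_closed S.sigma_sets_eq by (simp add: sets_measure_of)
qed

lemma subalgebra_ae_completion: "subalgebra M F \<Longrightarrow> subalgebra M (ae_completion M F)"
  by (auto simp: subalgebra_def[of M "ae_completion M F"] sets_ae_completion)

lemma ae_completion_mono:
  assumes "subalgebra M F" "subalgebra M F'" "sets F \<subseteq> sets F'"
  shows "subalgebra (ae_completion M F') (ae_completion M F)"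
  using assms(3) by (auto simp: subalgebra_def sets_ae_completion[OF assms(1)] sets_ae_completion[OF assms(2)])

lemma measurable_ae_completion:
  fixes Z Z' :: "'w \<Rightarrow> 'b::topological_space"
  assumes sub: "subalgebra M F" and Z: "Z \<in> borel_measurable M" and Z': "Z' \<in> borel_measurable F"
    and ae: "AE \<omega> in M. Z \<omega> = Z' \<omega>"
  shows "Z \<in> borel_measurable (ae_completion M F)"
proof (rule measurableI)
  fix B :: "'b set" assume B: "B \<in> sets borel"
  have "Z' -` B \<inter> space F \<in> sets F" using Z' B by (rule measurable_sets)
  moreover have "AE \<omega> in M. \<omega> \<in> Z -` B \<inter> space M \<longleftrightarrow> \<omega> \<in> Z' -` B \<inter> space F"
    using ae by eventually_elim (use sub in \<open>auto simp: subalgebra_def\<close>)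
  ultimately show "Z -` B \<inter> space (ae_completion M F) \<in> sets (ae_completion M F)"
    unfolding sets_ae_completion[OF sub] space_ae_completion using measurable_sets[OF Z B] by blast
qed simp

text \<open>
  The weight \<open>b\<close> will be the indicator of an event or its conditional probability.
\<close>

lemma Fubini_weighted:
  fixes X :: "'s \<Rightarrow> 'w \<Rightarrow> real"
  assumes "sigma_finite_measure L" "sigma_finite_measure M"
    and X: "integrable (L \<Otimes>\<^sub>M M) (\<lambda>(s, \<omega>). X s \<omega>)"
    and b [measurable]: "b \<in> borel_measurable M" and "\<And>\<omega>. \<bar>b \<omega>\<bar> \<le> 1"
  shows "integrable M (\<lambda>\<omega>. b \<omega> * (LINT s|L. X s \<omega>))"
    and "(LINT \<omega>|M. b \<omega> * (LINT s|L. X s \<omega>)) = (LINT s|L. LINT \<omega>|M. b \<omega> * X s \<omega>)"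
proof -
  interpret pair_sigma_finite L M using assms(1,2) by (simp add: pair_sigma_finite_def)
  note [measurable] = borel_measurable_integrable[OF X]
  have bX: "integrable (L \<Otimes>\<^sub>M M) (\<lambda>(s, \<omega>). b \<omega> * X s \<omega>)"
  proof (rule Bochner_Integration.integrable_bound[OF X])
    have "(\<lambda>z. b (snd z) * (case z of (s, \<omega>) \<Rightarrow> X s \<omega>)) \<in> borel_measurable (L \<Otimes>\<^sub>M M)" by measurable
    then show "(\<lambda>(s, \<omega>). b \<omega> * X s \<omega>) \<in> borel_measurable (L \<Otimes>\<^sub>M M)" by (simp add: case_prod_unfold)
    show "AE z in L \<Otimes>\<^sub>M M. norm (case z of (s, \<omega>) \<Rightarrow> b \<omega> * X s \<omega>) \<le> norm (case z of (s, \<omega>) \<Rightarrow> X s \<omega>)"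
      using assms(5) by (auto simp: abs_mult mult_left_le_one_le)
  qed
  show "integrable M (\<lambda>\<omega>. b \<omega> * (LINT s|L. X s \<omega>))"
    using integrable_snd[OF bX] by simp
  show "(LINT \<omega>|M. b \<omega> * (LINT s|L. X s \<omega>)) = (LINT s|L. LINT \<omega>|M. b \<omega> * X s \<omega>)"
    using Fubini_integral[OF bX] by simp
qed

text \<open>
  Let \<open>Z\<close> be the integral. For an event \<open>A\<close> of \<open>M\<close> with conditional probability \<open>b\<close> given \<open>F\<close>,
  self-adjointness of the conditional expectation and Fubini give
  \<open>E (1\<^sub>A * E (Z | F)) = E (b * Z) = \<integral> E (b * X s) ds = \<integral> E (1\<^sub>A * X s) ds = E (1\<^sub>A * Z)\<close>, where the third step
  uses that every single \<open>X s\<close> is measurable for \<open>F\<close>. Hence \<open>Z = E (Z | F)\<close> almost everywhere.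
\<close>

lemma (in prob_space) process_integral_ae_measurable:
  fixes X :: "'s \<Rightarrow> 'a \<Rightarrow> real"
  assumes "sigma_finite_measure L" and sub: "subalgebra M F"
    and X: "integrable (L \<Otimes>\<^sub>M M) (\<lambda>(s, \<omega>). X s \<omega>)"
    and Xs: "\<And>s. s \<in> space L \<Longrightarrow> X s \<in> borel_measurable F" "\<And>s. s \<in> space L \<Longrightarrow> integrable M (X s)"
  shows "(\<lambda>\<omega>. LINT s|L. X s \<omega>) \<in> borel_measurable (ae_completion M F)"
proof -
  interpret finite_measure_subalgebra M F by unfold_locales (rule sub)
  interpret MM: finite_measure_subalgebra M M by unfold_locales (simp add: subalgebra_def)
  note Fub = Fubini_weighted[OF assms(1) sigma_finite_measure_axioms X]
  define Z where "Z \<omega> = (LINT s|L. X s \<omega>)" for \<omega>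
  have Z: "integrable M Z" using Fub(1)[of "\<lambda>_. 1"] by (simp add: Z_def[abs_def])
  note [measurable] = borel_measurable_integrable[OF Z]
  define W where "W = real_cond_exp M F Z"
  have W: "W \<in> borel_measurable F" "integrable M W" unfolding W_def using Z by auto
  have eq: "(LINT \<omega>|M. indicator A \<omega> * W \<omega>) = (LINT \<omega>|M. indicator A \<omega> * Z \<omega>)"
    if A [measurable]: "A \<in> sets M" for A
  proof -
    let ?A = "indicator A :: 'a \<Rightarrow> real"
    define c where "c = real_cond_exp M F ?A"
    have [measurable]: "c \<in> borel_measurable F" unfolding c_def by simp
    \<comment> \<open>a version of the conditional probability that is bounded everywhere, as the weighted Fubini rule asks for\<close>
    define b where "b \<omega> = max 0 (min 1 (c \<omega>))" for \<omega>
    have bF [measurable]: "b \<in> borel_measurable F" unfolding b_def[abs_def] by measurable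
    have bM [measurable]: "b \<in> borel_measurable M" by (rule measurable_from_subalg[OF sub bF])
    have b1: "\<bar>b \<omega>\<bar> \<le> 1" for \<omega> by (simp add: b_def)
    have intA: "integrable M ?A" by (rule integrable_const_bound[of _ 1]) (auto simp: indicator_def)
    have "AE \<omega> in M. c \<omega> \<ge> 0" unfolding c_def by (rule real_cond_exp_pos) auto
    moreover have "AE \<omega> in M. c \<omega> \<le> 1" unfolding c_def
      by (rule real_cond_exp_le_c[OF intA]) (auto simp: indicator_def)
    ultimately have bc: "AE \<omega> in M. b \<omega> = c \<omega>" by eventually_elim (simp add: b_def)
    have intAf: "integrable M (\<lambda>\<omega>. ?A \<omega> * f \<omega>)" if "integrable M f" for f
      using integrable_mult_indicator[OF A that] by simp
    have cM [measurable]: "c \<in> borel_measurable M" by (rule measurable_from_subalg[OF sub]) measurable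
    have key: "(LINT \<omega>|M. f \<omega> * b \<omega>) = (LINT \<omega>|M. ?A \<omega> * f \<omega>)"
      if f: "f \<in> borel_measurable F" "integrable M f" for f
    proof -
      have [measurable]: "f \<in> borel_measurable M" using f(2) by simp
      have "(LINT \<omega>|M. f \<omega> * b \<omega>) = (LINT \<omega>|M. f \<omega> * c \<omega>)"
        by (rule integral_cong_AE) (use bc in auto)
      also have "\<dots> = (LINT \<omega>|M. f \<omega> * ?A \<omega>)" unfolding c_def
        by (rule real_cond_exp_intg) (use f intAf[OF f(2)] in \<open>auto simp: mult.commute\<close>)
      finally show ?thesis by (simp add: mult.commute)
    qed
    have "(LINT \<omega>|M. ?A \<omega> * W \<omega>) = (LINT \<omega>|M. b \<omega> * W \<omega>)" using key[OF W] by (simp add: mult.commute)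
    also have "\<dots> = (LINT \<omega>|M. b \<omega> * Z \<omega>)" unfolding W_def
    proof (rule real_cond_exp_intg(2)[OF _ bF])
      show "integrable M (\<lambda>\<omega>. b \<omega> * Z \<omega>)" using Fub(1)[OF bM b1] by (simp add: Z_def)
    qed measurable
    also have "\<dots> = (LINT s|L. LINT \<omega>|M. b \<omega> * X s \<omega>)"
      using Fub(2)[OF bM b1] by (simp add: Z_def)
    also have "\<dots> = (LINT s|L. LINT \<omega>|M. ?A \<omega> * X s \<omega>)"
      by (rule Bochner_Integration.integral_cong) (use key[OF Xs] in \<open>auto simp: mult.commute\<close>)
    also have "\<dots> = (LINT \<omega>|M. ?A \<omega> * Z \<omega>)"
      using Fub(2)[of ?A] by (simp add: Z_def indicator_def)
    finally show ?thesis .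
  qed
  \<comment> \<open>functions with equal integrals over all events agree, by uniqueness of the conditional expectation given the whole algebra\<close>
  have "AE \<omega> in M. real_cond_exp M M Z \<omega> = W \<omega>"
    by (rule MM.real_cond_exp_charact)
       (use eq Z W in \<open>auto simp: set_lebesgue_integral_def\<close>)
  moreover have "AE \<omega> in M. real_cond_exp M M Z \<omega> = Z \<omega>" using Z by (intro MM.real_cond_exp_F_meas) auto
  ultimately have "AE \<omega> in M. Z \<omega> = W \<omega>" by eventually_elim simp
  then have "Z \<in> borel_measurable (ae_completion M F)"
    by (rule measurable_ae_completion[OF sub borel_measurable_integrable[OF Z] W(1)])
  then show ?thesis by (simp add: Z_def[abs_def])
qed

text \<open>
  Expectations do not see null events, so that independence of \<open>F\<close> and \<open>F'\<close> suffices although \<open>A\<close> is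
  taken from the larger completed algebra.
\<close>

lemma (in prob_space) expectation_indicator_times_independent:
  fixes X :: "'a \<Rightarrow> real"
  assumes indep: "indep_set (sets F) (sets F')" and sub: "subalgebra M F" "subalgebra M F'"
    and X: "X \<in> borel_measurable F'" "integrable M X" "(LINT \<omega>|M. X \<omega>) = 0"
    and A: "A \<in> sets (ae_completion M F)"
  shows "(LINT \<omega>|M. indicator A \<omega> * X \<omega>) = 0"
proof -
  obtain A' where A': "A' \<in> sets F" "AE \<omega> in M. \<omega> \<in> A \<longleftrightarrow> \<omega> \<in> A'" and [measurable]: "A \<in> sets M"
    using A unfolding sets_ae_completion[OF sub(1)] by auto
  have [measurable]: "A' \<in> sets M" using A' sub unfolding subalgebra_def by auto
  have [measurable]: "X \<in> borel_measurable M" using X by simp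
  have sp: "space F = space M" "space F' = space M" using sub unfolding subalgebra_def by auto
  have "indep_var borel (indicator A' :: 'a \<Rightarrow> real) borel X"
    unfolding indep_var_eq
  proof (intro conjI)
    have ind: "(indicator A' :: 'a \<Rightarrow> real) \<in> borel_measurable F" using A' by measurable
    have 1: "sigma_sets (space M) {indicator A' -` B \<inter> space M | B :: real set. B \<in> sets borel} \<subseteq> sets F"
      unfolding sp(1)[symmetric] by (rule sets.sigma_sets_subset) (use measurable_sets[OF ind] in auto)
    have 2: "sigma_sets (space M) {X -` B \<inter> space M | B. B \<in> sets borel} \<subseteq> sets F'"
      unfolding sp(2)[symmetric] by (rule sets.sigma_sets_subset) (use measurable_sets[OF X(1)] in auto)
    show "indep_set (sigma_sets (space M) {indicator A' -` B \<inter> space M | B :: real set. B \<in> sets borel})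
       (sigma_sets (space M) {X -` B \<inter> space M | B. B \<in> sets borel})"
      using indep unfolding indep_set_def
      by (rule indep_sets_mono_sets) (use 1 2 in \<open>auto split: bool.split\<close>)
  qed measurable
  then have "(LINT \<omega>|M. indicator A' \<omega> * X \<omega>) = (LINT \<omega>|M. indicator A' \<omega>) * (LINT \<omega>|M. X \<omega>)"
    by (rule indep_var_lebesgue_integral)
       (use X(2) in \<open>auto intro!: integrable_const_bound[of _ 1] simp: indicator_def\<close>)
  also have "\<dots> = 0" using X by simp
  finally have "(LINT \<omega>|M. indicator A' \<omega> * X \<omega>) = 0" .
  moreover have "(LINT \<omega>|M. indicator A \<omega> * X \<omega>) = (LINT \<omega>|M. indicator A' \<omega> * X \<omega>)"
    by (rule integral_cong_AE) (use A'(2) in \<open>auto simp: indicator_def\<close>)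
  ultimately show ?thesis by simp
qed

section \<open>Pathwise integrals\<close>

lemma subspace_closure:
  fixes S :: "'a::real_normed_vector set"
  assumes "subspace S"
  shows "subspace (closure S)"
proof (rule subspaceI)
  show "0 \<in> closure S" using subspace_0[OF assms] by (rule subsetD[OF closure_subset])
next
  fix x y assume xy: "x \<in> closure S" "y \<in> closure S"
  obtain a where a: "\<And>n. a n \<in> S" "a \<longlonglongrightarrow> x" by (rule closure_limit_ex[OF xy(1)]) (rule that)
  obtain b where b: "\<And>n. b n \<in> S" "b \<longlonglongrightarrow> y" by (rule closure_limit_ex[OF xy(2)]) (rule that)
  show "x + y \<in> closure S"
    by (rule limit_in_closure[OF _ tendsto_add[OF a(2) b(2)]]) (intro subspace_add assms a b)
next
  fix c :: real and x assume x: "x \<in> closure S"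
  obtain a where a: "\<And>n. a n \<in> S" "a \<longlonglongrightarrow> x" by (rule closure_limit_ex[OF x]) (rule that)
  show "c *\<^sub>R x \<in> closure S"
    by (rule limit_in_closure[OF _ tendsto_scaleR[OF tendsto_const a(2)]]) (intro subspace_scale assms a)
qed

text \<open>
  The integral is a limit of Riemann sums, which are linear combinations of values of \<open>f\<close>. Applied to
  the closed span of a countable set this gives separability of the range of the noise; applied to the
  kernel of \<open>B\<close> it keeps the scheme in that kernel.
\<close>

lemma integral_in_closed_subspace:
  fixes f :: "real \<Rightarrow> 'a::real_normed_vector"
  assumes f: "f integrable_on {a..b}" "\<And>s. s \<in> {a..b} \<Longrightarrow> f s \<in> S" and S: "subspace S" "closed S"
  shows "integral {a..b} f \<in> S"
proof -
  have "integral {a..b} f \<in> closure S" unfolding closure_approachable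
  proof safe
    fix e :: real assume "e > 0"
    then obtain \<gamma> where \<gamma>: "gauge \<gamma>" "\<And>\<D>. \<D> tagged_division_of {a..b} \<Longrightarrow> \<gamma> fine \<D> \<Longrightarrow>
        norm ((\<Sum>(x, k)\<in>\<D>. measure lborel k *\<^sub>R f x) - integral {a..b} f) < e"
      using integrable_integral[OF f(1)] unfolding has_integral_real by metis
    obtain \<D> where \<D>: "\<D> tagged_division_of {a..b}" "\<gamma> fine \<D>"
      using fine_division_exists_real[OF \<gamma>(1)] by blast
    have "(\<Sum>(x, k)\<in>\<D>. measure lborel k *\<^sub>R f x) \<in> S"
    proof (rule subspace_sum[OF S(1)], clarify)
      fix x k assume "(x, k) \<in> \<D>"
      then have "x \<in> {a..b}" using tagged_division_ofD(2,3)[OF \<D>(1)] by blast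
      then show "measure lborel k *\<^sub>R f x \<in> S" by (intro subspace_scale[OF S(1)] f(2))
    qed
    moreover have "dist (\<Sum>(x, k)\<in>\<D>. measure lborel k *\<^sub>R f x) (integral {a..b} f) < e"
      using \<gamma>(2)[OF \<D>] by (simp add: dist_norm)
    ultimately show "\<exists>y\<in>S. dist y (integral {a..b} f) < e" by blast
  qed
  then show ?thesis using S(2) by simp
qed

lemma integral_in_op_ker:
  fixes B :: "'v::real_normed_vector \<Rightarrow>\<^sub>L 'q::real_normed_vector" and f :: "real \<Rightarrow> 'v"
  assumes "f integrable_on {a..b}" "\<And>s. s \<in> {a..b} \<Longrightarrow> f s \<in> op_ker B"
  shows "integral {a..b} f \<in> op_ker B"
proof (rule integral_in_closed_subspace[OF assms])
  show "subspace (op_ker B)"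
    by (auto simp: op_ker_def subspace_def blinfun.bilinear_simps)
  have "op_ker B = blinfun_apply B -` {0}" by (auto simp: op_ker_def)
  then show "closed (op_ker B)" by (simp add: continuous_closed_vimage linear_continuous_at blinfun.bounded_linear_right)
qed

lemma lebesgue_integral_eq_gauge_integral:
  fixes f :: "real \<Rightarrow> real"
  assumes f: "f \<in> borel_measurable (restrict_space borel {a..b})"
    and g: "g integrable_on {a..b}" "\<And>s. s \<in> {a..b} \<Longrightarrow> \<bar>f s\<bar> \<le> g s"
  shows "(LINT s|restrict_space lborel {a..b}. f s) = integral {a..b} f"
proof -
  let ?f = "\<lambda>s. indicator {a..b} s *\<^sub>R f s"
  have meas: "?f \<in> borel_measurable borel"
    using f by (subst (asm) borel_measurable_restrict_space_iff) auto
  have "?f absolutely_integrable_on {a..b}"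
  proof (rule measurable_bounded_by_integrable_imp_absolutely_integrable[OF _ _ g(1)])
    have "?f \<in> borel_measurable lebesgue" using meas by (intro measurable_completion) simp
    then show "?f \<in> borel_measurable (lebesgue_on {a..b})" by (rule measurable_restrict_space1)
  qed (use g(2) in auto)
  then have "integrable lebesgue (\<lambda>s. indicator {a..b} s *\<^sub>R ?f s)" unfolding set_integrable_def .
  then have "integrable lborel (\<lambda>s. indicator {a..b} s *\<^sub>R ?f s)"
    by (subst (asm) integrable_completion) (use meas in simp_all)
  then have "set_integrable lborel {a..b} ?f" unfolding set_integrable_def .
  then have "(LINT s:{a..b}|lborel. ?f s) = integral {a..b} ?f" by (rule set_borel_integral_eq_integral)
  also have "\<dots> = integral {a..b} f" by (rule integral_cong) simp
  also have "(LINT s:{a..b}|lborel. ?f s) = (LINT s|lborel. ?f s)"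
    unfolding set_lebesgue_integral_def by (rule Bochner_Integration.integral_cong) (auto simp: indicator_def)
  also have "\<dots> = (LINT s|restrict_space lborel {a..b}. f s)"
    by (subst integral_restrict_space) auto
  finally show ?thesis .
qed

section \<open>The noise of one step size\<close>

lemma centered_normal_mean:
  "integrable (centered_normal r) (\<lambda>x. x)" "(LINT x|centered_normal r. x) = 0"
proof -
  have "integrable (centered_normal r) (\<lambda>x. x) \<and> (LINT x|centered_normal r. x) = 0"
  proof (cases "r = 0")
    case True
    then have eq: "centered_normal r = return borel 0" by (simp add: centered_normal_def)
    interpret prob_space "return borel (0::real)" by (rule prob_space_return) simp
    have "integrable (return borel 0) (\<lambda>x::real. x)"
      by (rule integrable_const_bound[of _ 0]) (simp_all add: AE_return)
    moreover have "(LINT x|return borel (0::real). x) = 0" by (rule integral_return) simp_all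
    ultimately show ?thesis unfolding eq by blast
  next
    case False
    have "normal_density 0 r = normal_density 0 \<bar>r\<bar>" by (simp add: normal_density_def fun_eq_iff)
    then have eq: "centered_normal r = density lborel (\<lambda>x. ennreal (normal_density 0 \<bar>r\<bar> x))"
      using False by (simp add: centered_normal_def)
    have "0 < \<bar>r\<bar>" using False by simp
    from integrable_normal_moment_nz_1[OF this, of 0] integral_normal_moment_nz_1[OF this, of 0]
    show ?thesis unfolding eq by (simp add: integrable_density integral_density)
  qed
  then show "integrable (centered_normal r) (\<lambda>x. x)" "(LINT x|centered_normal r. x) = 0" by auto
qed

text \<open>
  The events that depend on the paths of the steps \<open>m \<in> I\<close> only.
\<close>

definition path_algebra ::
  "'w measure \<Rightarrow> real \<Rightarrow> (nat \<Rightarrow> real \<Rightarrow> 'w \<Rightarrow> 'v::real_normed_vector) \<Rightarrow> nat set \<Rightarrow> 'w measure" where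
  "path_algebra M \<tau> \<eta> I = sigma (space M)
     (\<Union>m\<in>I. {path_on {0..\<tau>} (\<eta> m) -` A \<inter> space M | A. A \<in> sets (\<Pi>\<^sub>M s\<in>{0..\<tau>}. borel)})"

lemma space_path_algebra [simp]: "space (path_algebra M \<tau> \<eta> I) = space M"
  by (simp add: path_algebra_def space_measure_of_conv)

lemma sets_path_algebra:
  "sets (path_algebra M \<tau> \<eta> I) = sigma_sets (space M)
     (\<Union>m\<in>I. {path_on {0..\<tau>} (\<eta> m) -` A \<inter> space M | A. A \<in> sets (\<Pi>\<^sub>M s\<in>{0..\<tau>}. borel)})"
  unfolding path_algebra_def by (rule sets_measure_of) auto

lemma path_algebra_mono: "I \<subseteq> J \<Longrightarrow> sets (path_algebra M \<tau> \<eta> I) \<subseteq> sets (path_algebra M \<tau> \<eta> J)"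
  unfolding sets_path_algebra by (intro sigma_sets_mono') auto

lemma measurable_path_algebra:
  fixes \<eta> :: "nat \<Rightarrow> real \<Rightarrow> 'w \<Rightarrow> 'v::real_normed_vector"
  assumes "m \<in> I" "s \<in> {0..\<tau>}"
  shows "\<eta> m s \<in> borel_measurable (path_algebra M \<tau> \<eta> I)"
proof -
  let ?P = "\<Pi>\<^sub>M s\<in>{0..\<tau>}. (borel :: 'v measure)"
  have "path_on {0..\<tau>} (\<eta> m) \<in> measurable (path_algebra M \<tau> \<eta> I) ?P"
  proof (rule measurableI)
    fix A assume "A \<in> sets ?P"
    then show "path_on {0..\<tau>} (\<eta> m) -` A \<inter> space (path_algebra M \<tau> \<eta> I) \<in> sets (path_algebra M \<tau> \<eta> I)"
      unfolding sets_path_algebra using assms(1) by (intro sigma_sets.Basic) auto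
  qed (auto simp: path_on_def space_PiM)
  then have "(\<lambda>\<omega>. path_on {0..\<tau>} (\<eta> m) \<omega> s) \<in> borel_measurable (path_algebra M \<tau> \<eta> I)"
    by (rule measurable_compose[OF _ measurable_component_singleton[OF assms(2)]])
  then show ?thesis using assms(2) by (simp add: path_on_def)
qed

lemma (in prob_space) path_algebra_indep:
  fixes \<eta> :: "nat \<Rightarrow> real \<Rightarrow> 'a \<Rightarrow> 'v::real_normed_vector"
  assumes ind: "indep_vars (\<lambda>_. \<Pi>\<^sub>M s\<in>{0..\<tau>}. borel) (\<lambda>n. path_on {0..\<tau>} (\<eta> n)) UNIV"
  shows "subalgebra M (path_algebra M \<tau> \<eta> I)"
    and "I \<inter> J = {} \<Longrightarrow> indep_set (sets (path_algebra M \<tau> \<eta> I)) (sets (path_algebra M \<tau> \<eta> J))"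
proof -
  let ?P = "\<Pi>\<^sub>M s\<in>{0..\<tau>}. (borel :: 'v measure)"
  let ?E = "\<lambda>n. {path_on {0..\<tau>} (\<eta> n) -` A \<inter> space M | A. A \<in> sets ?P}"
  have meas: "\<And>n. path_on {0..\<tau>} (\<eta> n) \<in> measurable M ?P" and E: "indep_sets ?E UNIV"
    using ind unfolding indep_vars_def2 by auto
  have "(\<Union>m\<in>I. ?E m) \<subseteq> sets M" using measurable_sets[OF meas] by blast
  then show "subalgebra M (path_algebra M \<tau> \<eta> I)"
    unfolding subalgebra_def sets_path_algebra by (simp add: sets.sigma_sets_subset)
  assume IJ: "I \<inter> J = {}"
  have "indep_sets (\<lambda>j. sigma_sets (space M) (\<Union>i\<in>case_bool I J j. ?E i)) UNIV"
  proof (rule indep_sets_collect_sigma)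
    show "indep_sets ?E (\<Union>j\<in>UNIV. case_bool I J j)" by (rule indep_sets_mono_index[OF _ E]) simp
    show "disjoint_family_on (case_bool I J) UNIV"
      using IJ unfolding disjoint_family_on_def by (auto split: bool.split)
    fix i
    show "Int_stable (?E i)"
    proof (rule Int_stableI)
      fix a b assume "a \<in> ?E i" "b \<in> ?E i"
      then obtain A B where "A \<in> sets ?P" "B \<in> sets ?P"
          "a = path_on {0..\<tau>} (\<eta> i) -` A \<inter> space M" "b = path_on {0..\<tau>} (\<eta> i) -` B \<inter> space M" by blast
      then show "a \<inter> b \<in> ?E i" by (intro CollectI exI[of _ "A \<inter> B"]) auto
    qed
  qed
  moreover have "(\<lambda>j. sigma_sets (space M) (\<Union>i\<in>case_bool I J j. ?E i))
      = case_bool (sets (path_algebra M \<tau> \<eta> I)) (sets (path_algebra M \<tau> \<eta> J))"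
    by (auto simp: fun_eq_iff sets_path_algebra split: bool.split)
  ultimately show "indep_set (sets (path_algebra M \<tau> \<eta> I)) (sets (path_algebra M \<tau> \<eta> J))"
    unfolding indep_set_def by simp
qed

lemma measurable_blinfun_compose:
  assumes "X \<in> borel_measurable M"
  shows "(\<lambda>\<omega>. blinfun_apply \<phi> (X \<omega>)) \<in> borel_measurable M"
proof (rule measurable_compose[OF assms])
  show "blinfun_apply \<phi> \<in> borel_measurable borel"
    by (intro borel_measurable_continuous_onI continuous_intros)
qed

context
  fixes M :: "'w measure" and \<iota> :: "'v::real_normed_vector \<Rightarrow>\<^sub>L 'h::real_inner"
    and W :: "'v set" and \<tau> \<sigma> C p :: real and \<eta> :: "nat \<Rightarrow> real \<Rightarrow> 'w \<Rightarrow> 'v"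
    and K :: "('v \<Rightarrow>\<^sub>L real) \<Rightarrow>\<^sub>L ('v \<Rightarrow>\<^sub>L real) \<Rightarrow>\<^sub>L real"
  assumes M: "prob_space M" and noise: "noise_assumption M \<iota> W \<tau> \<eta> \<sigma> K C p" and \<tau>: "\<tau> > 0"
begin

interpretation prob_space M by (rule M)

abbreviation "time_measure \<equiv> restrict_space lborel {0..\<tau>}"

lemma finite_time: "finite_measure time_measure"
  by (rule finite_measureI) (use \<tau> in \<open>simp add: emeasure_restrict_space space_restrict_space\<close>)

lemma sigma_finite_time: "sigma_finite_measure time_measure"
  using finite_time by (simp add: finite_measure_def)

lemma noise_meas: "s \<in> {0..\<tau>} \<Longrightarrow> \<eta> n s \<in> borel_measurable M"
  using noise unfolding noise_assumption_def centered_gaussian_process_def by blast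

text \<open>
  The last equation matters because its right-hand side does not involve \<open>s\<close>: the absolute first moment
  is constant in time, and so the process is integrable over time and events together.
\<close>

lemma noise_scalar_mean:
  fixes \<phi> :: "'v \<Rightarrow>\<^sub>L real"
  assumes "s \<in> {0..\<tau>}"
  shows "integrable M (\<lambda>\<omega>. blinfun_apply \<phi> (\<eta> n s \<omega>))" "(LINT \<omega>|M. blinfun_apply \<phi> (\<eta> n s \<omega>)) = 0"
    and "(LINT \<omega>|M. \<bar>blinfun_apply \<phi> (\<eta> n s \<omega>)\<bar>)
      = (LINT x|centered_normal (\<sigma> * sqrt (blinfun_apply (blinfun_apply K \<phi>) \<phi>)). \<bar>x\<bar>)"
proof -
  let ?N = "centered_normal (\<sigma> * sqrt (blinfun_apply (blinfun_apply K \<phi>) \<phi>))"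
  have law: "distr M borel (\<lambda>\<omega>. blinfun_apply \<phi> (\<eta> n s \<omega>)) = ?N"
    using noise assms unfolding noise_assumption_def normal_law_def by blast
  have [measurable]: "(\<lambda>\<omega>. blinfun_apply \<phi> (\<eta> n s \<omega>)) \<in> borel_measurable M"
    by (rule measurable_blinfun_compose[OF noise_meas[OF assms]])
  show "integrable M (\<lambda>\<omega>. blinfun_apply \<phi> (\<eta> n s \<omega>))"
    by (rule integrable_distr[of _ M borel "\<lambda>x. x"]) (simp_all add: law centered_normal_mean)
  show "(LINT \<omega>|M. blinfun_apply \<phi> (\<eta> n s \<omega>)) = 0"
  proof -
    have "(LINT \<omega>|M. blinfun_apply \<phi> (\<eta> n s \<omega>)) = (LINT x|?N. x)"
      unfolding law[symmetric] by (rule integral_distr[symmetric]) measurable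
    then show ?thesis by (simp only: centered_normal_mean(2))
  qed
  show "(LINT \<omega>|M. \<bar>blinfun_apply \<phi> (\<eta> n s \<omega>)\<bar>) = (LINT x|?N. \<bar>x\<bar>)"
    unfolding law[symmetric] by (rule integral_distr[symmetric]) measurable
qed

lemma noise_joint: "strongly_measurable (restrict_space borel {0..\<tau>} \<Otimes>\<^sub>M M) (\<lambda>(s, \<omega>). \<eta> n s \<omega>)"
  using noise unfolding noise_assumption_def by blast

lemma noise_scalar_joint:
  fixes \<phi> :: "'v \<Rightarrow>\<^sub>L real"
  shows
  "(\<lambda>(s, \<omega>). blinfun_apply \<phi> (\<eta> n s \<omega>)) \<in> borel_measurable (restrict_space borel {0..\<tau>} \<Otimes>\<^sub>M M)"
proof -
  have "(\<lambda>(s, \<omega>). \<eta> n s \<omega>) \<in> borel_measurable (restrict_space borel {0..\<tau>} \<Otimes>\<^sub>M M)"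
    using noise_joint[of n] unfolding strongly_measurable_def by blast
  from measurable_blinfun_compose[OF this] show ?thesis by (simp add: case_prod_unfold)
qed

lemma noise_scalar_integrable:
  fixes \<phi> :: "'v \<Rightarrow>\<^sub>L real"
  shows
  "integrable (time_measure \<Otimes>\<^sub>M M) (\<lambda>(s, \<omega>). blinfun_apply \<phi> (\<eta> n s \<omega>))"
proof -
  interpret L: sigma_finite_measure time_measure by (rule sigma_finite_time)
  interpret pair_sigma_finite time_measure M ..
  have sp: "space time_measure = {0..\<tau>}" by (simp add: space_restrict_space)
  have "sets (restrict_space borel {0..\<tau>} \<Otimes>\<^sub>M M) = sets (time_measure \<Otimes>\<^sub>M M)"
    by (intro sets_pair_measure_cong sets_restrict_space_cong) auto
  then have meas: "(\<lambda>(s, \<omega>). blinfun_apply \<phi> (\<eta> n s \<omega>)) \<in> borel_measurable (time_measure \<Otimes>\<^sub>M M)"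
    using noise_scalar_joint by (simp cong: measurable_cong_sets)
  show ?thesis
  proof (rule Fubini_integrable[OF meas])
    have "integrable time_measure (\<lambda>s. LINT x|centered_normal (\<sigma> * sqrt (blinfun_apply (blinfun_apply K \<phi>) \<phi>)). \<bar>x\<bar>)"
      by (rule finite_measure.integrable_const[OF finite_time])
    then show "integrable time_measure
        (\<lambda>s. LINT \<omega>|M. norm (case (s, \<omega>) of (s, \<omega>) \<Rightarrow> blinfun_apply \<phi> (\<eta> n s \<omega>)))"
      by (rule Bochner_Integration.integrable_cong[THEN iffD1, rotated -1])
         (use noise_scalar_mean(3) sp in auto)
    show "AE s in time_measure. integrable M (\<lambda>\<omega>. case (s, \<omega>) of (s, \<omega>) \<Rightarrow> blinfun_apply \<phi> (\<eta> n s \<omega>))"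
      using noise_scalar_mean(1) sp by (intro AE_I2) auto
  qed
qed

text \<open>
  A gauge integral with values in \<open>'v\<close> commutes with functionals, and for the resulting real function it
  becomes a Lebesgue integral, for which Fubini is available.
\<close>

lemma noise_integral_scalar:
  fixes \<phi> :: "'v \<Rightarrow>\<^sub>L real"
  assumes \<omega>: "\<omega> \<in> space M"
  shows "blinfun_apply \<phi> (noise_integral \<eta> n \<tau> \<omega>) = (LINT s|time_measure. blinfun_apply \<phi> (\<eta> n s \<omega>))"
proof -
  have int: "(\<lambda>s. \<eta> n s \<omega>) integrable_on {0..\<tau>}" "(\<lambda>s. norm (\<eta> n s \<omega>)) integrable_on {0..\<tau>}"
    using noise \<omega> unfolding noise_assumption_def by blast+
  have "(\<lambda>s. blinfun_apply \<phi> (\<eta> n s \<omega>)) \<in> borel_measurable (restrict_space borel {0..\<tau>})"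
    using measurable_Pair1[OF noise_scalar_joint \<omega>] by simp
  then have "(LINT s|time_measure. blinfun_apply \<phi> (\<eta> n s \<omega>)) = integral {0..\<tau>} (\<lambda>s. blinfun_apply \<phi> (\<eta> n s \<omega>))"
  proof (rule lebesgue_integral_eq_gauge_integral)
    show "(\<lambda>s. norm \<phi> * norm (\<eta> n s \<omega>)) integrable_on {0..\<tau>}"
      using int(2) by (rule integrable_on_mult_right)
    show "\<bar>blinfun_apply \<phi> (\<eta> n s \<omega>)\<bar> \<le> norm \<phi> * norm (\<eta> n s \<omega>)" for s
      using norm_blinfun[of \<phi> "\<eta> n s \<omega>"] by simp
  qed
  also have "\<dots> = blinfun_apply \<phi> (noise_integral \<eta> n \<tau> \<omega>)"
    using integral_linear[OF int(1) blinfun.bounded_linear_right[of \<phi>]] by (simp add: noise_integral_def o_def)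
  finally show ?thesis by simp
qed

lemma indep_paths: "indep_vars (\<lambda>_. \<Pi>\<^sub>M s\<in>{0..\<tau>}. borel) (\<lambda>n. path_on {0..\<tau>} (\<eta> n)) UNIV"
  using noise unfolding noise_assumption_def by blast

text \<open>
  Everything that the scheme has used up to its \<open>n\<close>-th value.
\<close>

abbreviation "past n \<equiv> ae_completion M (path_algebra M \<tau> \<eta> {..<n})"

lemma past_subalgebra: "subalgebra M (past n)" "subalgebra (past (Suc n)) (past n)"
  by (auto intro!: subalgebra_ae_completion ae_completion_mono path_algebra_indep(1)[OF indep_paths]
      path_algebra_mono)

lemma noise_integral_scalar_past:
  fixes \<phi> :: "'v \<Rightarrow>\<^sub>L real"
  assumes "m < n"
  shows "(\<lambda>\<omega>. blinfun_apply \<phi> (noise_integral \<eta> m \<tau> \<omega>)) \<in> borel_measurable (past n)"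
proof -
  have "(\<lambda>\<omega>. LINT s|time_measure. blinfun_apply \<phi> (\<eta> m s \<omega>)) \<in> borel_measurable (past n)"
    by (rule process_integral_ae_measurable[OF sigma_finite_time path_algebra_indep(1)[OF indep_paths]
          noise_scalar_integrable])
       (use assms in \<open>auto simp: space_restrict_space
          intro!: measurable_blinfun_compose measurable_path_algebra noise_scalar_mean(1)\<close>)
  then show ?thesis by (rule measurable_cong[THEN iffD1, rotated]) (simp add: noise_integral_scalar)
qed

text \<open>
  By Fubini the expectation is a time average of the expectations of \<open>1\<^sub>A * \<phi> (\<eta> n s)\<close>. Each of these
  vanishes, since the value of the path of step \<open>n\<close> at the single time \<open>s\<close> is independent of \<open>A\<close> and
  centered.
\<close>

lemma noise_integral_uncorrelated_past:
  fixes \<phi> :: "'v \<Rightarrow>\<^sub>L real"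
  assumes A: "A \<in> sets (past n)"
  shows "(LINT \<omega>|M. indicator A \<omega> * blinfun_apply \<phi> (noise_integral \<eta> n \<tau> \<omega>)) = 0"
proof -
  have AM: "A \<in> sets M" using A past_subalgebra(1)[of n] unfolding subalgebra_def by auto
  have "(LINT \<omega>|M. indicator A \<omega> * blinfun_apply \<phi> (noise_integral \<eta> n \<tau> \<omega>))
      = (LINT \<omega>|M. indicator A \<omega> * (LINT s|time_measure. blinfun_apply \<phi> (\<eta> n s \<omega>)))"
    by (rule Bochner_Integration.integral_cong) (simp_all add: noise_integral_scalar)
  also have "\<dots> = (LINT s|time_measure. LINT \<omega>|M. indicator A \<omega> * blinfun_apply \<phi> (\<eta> n s \<omega>))"
    by (rule Fubini_weighted(2)[OF sigma_finite_time sigma_finite_measure_axioms noise_scalar_integrable])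
       (use AM in \<open>auto simp: indicator_def\<close>)
  also have "\<dots> = (LINT s|time_measure. 0)"
  proof (rule Bochner_Integration.integral_cong)
    fix s assume "s \<in> space time_measure"
    then have s: "s \<in> {0..\<tau>}" by (simp add: space_restrict_space)
    show "(LINT \<omega>|M. indicator A \<omega> * blinfun_apply \<phi> (\<eta> n s \<omega>)) = 0"
    proof (rule expectation_indicator_times_independent[OF _ _ _ _ _ _ A])
      show "indep_set (sets (path_algebra M \<tau> \<eta> {..<n})) (sets (path_algebra M \<tau> \<eta> {n}))"
        by (rule path_algebra_indep(2)[OF indep_paths]) simp
      show "(\<lambda>\<omega>. blinfun_apply \<phi> (\<eta> n s \<omega>)) \<in> borel_measurable (path_algebra M \<tau> \<eta> {n})"
        by (intro measurable_blinfun_compose measurable_path_algebra s) simp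
    qed (intro path_algebra_indep(1)[OF indep_paths] noise_scalar_mean s)+
  qed simp
  finally show ?thesis by simp
qed

lemma noise_integral_strongly_past:
  assumes "m < n"
  shows "strongly_measurable (past n) (\<lambda>\<omega>. blinfun_apply \<iota> (noise_integral \<eta> m \<tau> \<omega>))"
proof -
  obtain D where D: "countable D"
      "(\<lambda>(s, \<omega>). \<eta> m s \<omega>) ` space (restrict_space borel {0..\<tau>} \<Otimes>\<^sub>M M) \<subseteq> closure D"
    using noise_joint[of m] unfolding strongly_measurable_def by blast
  show ?thesis
  proof (rule pettis_measurability)
    fix h
    have "(\<lambda>\<omega>. blinfun_apply (blinfun_inner_right h o\<^sub>L \<iota>) (noise_integral \<eta> m \<tau> \<omega>)) \<in> borel_measurable (past n)"
      by (rule noise_integral_scalar_past[OF assms])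
    then show "(\<lambda>\<omega>. h \<bullet> blinfun_apply \<iota> (noise_integral \<eta> m \<tau> \<omega>)) \<in> borel_measurable (past n)" by simp
  next
    show "countable (blinfun_apply \<iota> ` D)" using D(1) by simp
    show "(\<lambda>\<omega>. blinfun_apply \<iota> (noise_integral \<eta> m \<tau> \<omega>)) ` space (past n) \<subseteq> closure (span (blinfun_apply \<iota> ` D))"
    proof safe
      fix \<omega> assume "\<omega> \<in> space (past n)"
      then have \<omega>: "\<omega> \<in> space M" by simp
      have "noise_integral \<eta> m \<tau> \<omega> \<in> closure (span D)" unfolding noise_integral_def
      proof (rule integral_in_closed_subspace)
        show "(\<lambda>s. \<eta> m s \<omega>) integrable_on {0..\<tau>}"
          using noise \<omega> unfolding noise_assumption_def by blast
        fix s assume "s \<in> {0..\<tau>}"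
        then have "\<eta> m s \<omega> \<in> closure D"
          using subsetD[OF D(2) image_eqI[of _ _ "(s, \<omega>)"]] \<omega>
          by (simp add: space_pair_measure space_restrict_space)
        then show "\<eta> m s \<omega> \<in> closure (span D)" by (rule subsetD[OF closure_mono[OF span_superset]])
      qed (auto intro: subspace_closure)
      then have "blinfun_apply \<iota> (noise_integral \<eta> m \<tau> \<omega>) \<in> blinfun_apply \<iota> ` closure (span D)" by simp
      also have "\<dots> \<subseteq> closure (blinfun_apply \<iota> ` span D)"
        by (rule image_closure_subset) (auto intro!: continuous_intros closure_subset)
      also have "blinfun_apply \<iota> ` span D = span (blinfun_apply \<iota> ` D)"
        by (rule linear_span_image[symmetric]) (rule bounded_linear.linear[OF blinfun.bounded_linear_right])
      finally show "blinfun_apply \<iota> (noise_integral \<eta> m \<tau> \<omega>) \<in> closure (span (blinfun_apply \<iota> ` D))" .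
    qed
  qed
qed

end

section \<open>Mean-square stability of perturbed one-step schemes\<close>

text \<open>
  With \<open>Y = \<Phi> n (c n) - \<Phi> n (X n)\<close> the deviation after the next step is \<open>Y - \<xi> n\<close>. As \<open>Y\<close> belongs to the
  past \<open>G n\<close>, to which \<open>\<xi> n\<close> is uncorrelated, the mean squares add up without a mixed term:
  \<open>a (n + 1) \<le> r\<^sup>2 * a n + \<kappa>\<close>. Measurability of \<open>X n\<close> with respect to the past has to be carried along in
  the same induction.
\<close>

lemma mean_square_perturbation:
  fixes X \<xi> :: "nat \<Rightarrow> 'w \<Rightarrow> 'h::real_inner" and c :: "nat \<Rightarrow> 'h" and \<Phi> :: "nat \<Rightarrow> 'h \<Rightarrow> 'h"
  assumes M: "finite_measure M"
    and G: "\<And>n. subalgebra M (G n)" "\<And>n. subalgebra (G (Suc n)) (G n)"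
    and X0: "\<And>\<omega>. X 0 \<omega> = c 0"
    and X: "\<And>n \<omega>. n < N \<Longrightarrow> X (Suc n) \<omega> = \<Phi> n (X n \<omega>) + \<xi> n \<omega>"
    and c: "\<And>n. n < N \<Longrightarrow> c (Suc n) = \<Phi> n (c n)"
    and S: "\<And>n \<omega>. n < N \<Longrightarrow> \<omega> \<in> space M \<Longrightarrow> X n \<omega> \<in> S" "\<And>n. n < N \<Longrightarrow> c n \<in> S"
    and Lip: "\<And>n x y. n < N \<Longrightarrow> x \<in> S \<Longrightarrow> y \<in> S \<Longrightarrow> norm (\<Phi> n x - \<Phi> n y) \<le> r * norm (x - y)"
    and r: "r \<ge> 1"
    and \<xi>: "\<And>n. strongly_measurable (G (Suc n)) (\<xi> n)"
      "\<And>n. integrable M (\<lambda>\<omega>. (norm (\<xi> n \<omega>))\<^sup>2)"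
      "\<And>n. (LINT \<omega>|M. (norm (\<xi> n \<omega>))\<^sup>2) \<le> \<kappa>"
      "\<And>n h A. A \<in> sets (G n) \<Longrightarrow> (LINT \<omega>|M. indicator A \<omega> * (h \<bullet> \<xi> n \<omega>)) = 0"
    and n: "n \<le> N"
  shows "strongly_measurable (G n) (X n) \<and> integrable M (\<lambda>\<omega>. (norm (c n - X n \<omega>))\<^sup>2) \<and>
      (LINT \<omega>|M. (norm (c n - X n \<omega>))\<^sup>2) \<le> n * \<kappa> * (r\<^sup>2) ^ n"
proof -
  have \<kappa>0: "\<kappa> \<ge> 0"
    using order_trans[OF integral_nonneg_AE \<xi>(3)[of 0]] by simp
  have norm2_meas: "(\<lambda>\<omega>. (norm (V \<omega>))\<^sup>2) \<in> borel_measurable M" if "strongly_measurable M V"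
    for V :: "'w \<Rightarrow> 'h"
  proof -
    have [measurable]: "V \<in> borel_measurable M" using that unfolding strongly_measurable_def by simp
    show ?thesis by measurable
  qed
  show ?thesis
    using n
  proof (induction n)
    case 0
    show ?case by (simp add: X0 strongly_measurable_const)
  next
    case (Suc n)
    then have n: "n < N" and sm: "strongly_measurable (G n) (X n)"
      and int: "integrable M (\<lambda>\<omega>. (norm (c n - X n \<omega>))\<^sup>2)"
      and le: "(LINT \<omega>|M. (norm (c n - X n \<omega>))\<^sup>2) \<le> n * \<kappa> * (r\<^sup>2) ^ n" by auto
    have sp: "space (G n) = space M" using G(1)[of n] unfolding subalgebra_def by simp
    have contL: "(r)-lipschitz_on S (\<Phi> n)"
      using Lip[OF n] r by (intro lipschitz_onI) (auto simp: dist_norm)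
    have cont: "continuous_on S (\<Phi> n)" by (rule lipschitz_on_continuous_on[OF contL])
    have \<Phi>X: "strongly_measurable (G n) (\<lambda>\<omega>. \<Phi> n (X n \<omega>))"
      by (rule strongly_measurable_compose[OF sm _ cont]) (use S(1)[OF n] sp in auto)
    define Y where "Y \<omega> = \<Phi> n (c n) - \<Phi> n (X n \<omega>)" for \<omega>
    have contY: "continuous_on S (\<lambda>x. \<Phi> n (c n) - \<Phi> n x)" by (intro continuous_intros cont)
    have Y: "strongly_measurable (G n) Y" unfolding Y_def
      by (rule strongly_measurable_compose[OF sm _ contY]) (use S(1)[OF n] sp in auto)
    have YM: "strongly_measurable M Y" by (rule strongly_measurable_subalgebra[OF G(1) Y])
    have \<xi>M: "strongly_measurable M (\<xi> n)" by (rule strongly_measurable_subalgebra[OF G(1) \<xi>(1)])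
    have Yle: "(norm (Y \<omega>))\<^sup>2 \<le> r\<^sup>2 * (norm (c n - X n \<omega>))\<^sup>2" if "\<omega> \<in> space M" for \<omega>
      using Lip[OF n S(2)[OF n] S(1)[OF n that]] unfolding Y_def power_mult_distrib[symmetric]
      by (intro power_mono) auto
    have Y2: "integrable M (\<lambda>\<omega>. (norm (Y \<omega>))\<^sup>2)"
    proof (rule Bochner_Integration.integrable_bound)
      show "integrable M (\<lambda>\<omega>. r\<^sup>2 * (norm (c n - X n \<omega>))\<^sup>2)" using int by simp
      show "(\<lambda>\<omega>. (norm (Y \<omega>))\<^sup>2) \<in> borel_measurable M" by (rule norm2_meas[OF YM])
    qed (use Yle in auto)
    note orth = orthogonal_if_uncorrelated_on_events[OF M G(1) Y measurable_inner_strongly[OF \<xi>M] Y2 \<xi>(2) \<xi>(4)]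
    have expand: "(norm (c (Suc n) - X (Suc n) \<omega>))\<^sup>2
        = (norm (Y \<omega>))\<^sup>2 - 2 * (Y \<omega> \<bullet> \<xi> n \<omega>) + (norm (\<xi> n \<omega>))\<^sup>2" for \<omega>
    proof -
      have "c (Suc n) - X (Suc n) \<omega> = Y \<omega> - \<xi> n \<omega>" by (simp add: X[OF n] c[OF n] Y_def)
      then show ?thesis
        by (simp add: power2_norm_eq_inner inner_diff_left inner_diff_right inner_commute)
    qed
    have int': "integrable M (\<lambda>\<omega>. (norm (c (Suc n) - X (Suc n) \<omega>))\<^sup>2)"
      unfolding expand using Y2 orth(1) \<xi>(2)[of n] by simp
    have "(LINT \<omega>|M. (norm (c (Suc n) - X (Suc n) \<omega>))\<^sup>2)
        = (LINT \<omega>|M. (norm (Y \<omega>))\<^sup>2) + (LINT \<omega>|M. (norm (\<xi> n \<omega>))\<^sup>2)"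
      unfolding expand using Y2 orth \<xi>(2)[of n] by simp
    also have "(LINT \<omega>|M. (norm (Y \<omega>))\<^sup>2) \<le> (LINT \<omega>|M. r\<^sup>2 * (norm (c n - X n \<omega>))\<^sup>2)"
      by (rule integral_mono) (use Y2 int Yle in auto)
    also have "\<dots> \<le> r\<^sup>2 * (n * \<kappa> * (r\<^sup>2) ^ n)" using le by (simp add: mult_left_mono)
    also have "(LINT \<omega>|M. (norm (\<xi> n \<omega>))\<^sup>2) \<le> \<kappa> * (r\<^sup>2) ^ Suc n"
    proof -
      have "1 \<le> (r\<^sup>2) ^ Suc n" using r by (intro one_le_power) auto
      then have "\<kappa> * 1 \<le> \<kappa> * (r\<^sup>2) ^ Suc n" using \<kappa>0 by (intro mult_left_mono)
      then show ?thesis using \<xi>(3)[of n] by linarith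
    qed
    also have "r\<^sup>2 * (n * \<kappa> * (r\<^sup>2) ^ n) + \<kappa> * (r\<^sup>2) ^ Suc n = Suc n * \<kappa> * (r\<^sup>2) ^ Suc n"
      by (simp add: algebra_simps)
    finally have bound: "(LINT \<omega>|M. (norm (c (Suc n) - X (Suc n) \<omega>))\<^sup>2) \<le> Suc n * \<kappa> * (r\<^sup>2) ^ Suc n"
      by simp
    have "X (Suc n) = (\<lambda>\<omega>. \<Phi> n (X n \<omega>) + \<xi> n \<omega>)" using X[OF n] by auto
    then have "strongly_measurable (G (Suc n)) (X (Suc n))"
      using strongly_measurable_add[OF strongly_measurable_subalgebra[OF G(2) \<Phi>X] \<xi>(1)] by simp
    with int' bound show ?case by blast
  qed
qed

lemma square_norm_add_le:
  fixes a b :: "'a::real_normed_vector"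
  shows "(norm (a + b))\<^sup>2 \<le> 2 * (norm a)\<^sup>2 + 2 * (norm b)\<^sup>2"
proof -
  have "(norm (a + b))\<^sup>2 \<le> (norm a + norm b)\<^sup>2" by (intro power_mono norm_triangle_ineq) simp
  also have "\<dots> \<le> 2 * (norm a)\<^sup>2 + 2 * (norm b)\<^sup>2"
    using sum_squares_bound[of "norm a" "norm b"] by (simp add: power2_sum)
  finally show ?thesis .
qed

text \<open>
  One power of \<open>\<tau>\<close> is spent on the number of steps, \<open>n * \<tau> \<le> T\<close>; the growth factor is absorbed by
  \<open>1 + L * \<tau> \<le> exp (L * \<tau>)\<close>.
\<close>

lemma discrete_gronwall_bound:
  fixes L \<tau> T \<kappa> p :: real
  assumes "\<tau> > 0" "L > 0" "real n * \<tau> \<le> T" "\<kappa> > 0"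
  shows "n * (\<kappa> * \<tau> powr (2 * p + 1)) * ((1 + L * \<tau>)\<^sup>2) ^ n \<le> T * \<kappa> * exp (2 * L * T) * (\<tau> powr p)\<^sup>2"
proof -
  have "\<tau> powr (2 * p + 1) = \<tau> powr (p + p + 1)" by (simp add: algebra_simps)
  also have "\<dots> = (\<tau> powr p)\<^sup>2 * \<tau>" using assms(1) by (simp only: powr_add powr_one power2_eq_square less_imp_le)
  finally have powr: "\<tau> powr (2 * p + 1) = (\<tau> powr p)\<^sup>2 * \<tau>" .
  have "((1 + L * \<tau>)\<^sup>2) ^ n = (1 + L * \<tau>) ^ (2 * n)" by (simp add: power_mult)
  also have "\<dots> \<le> exp (L * \<tau>) ^ (2 * n)"
    using assms by (intro power_mono exp_ge_add_one_self) (simp add: add_nonneg_nonneg)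
  also have "\<dots> = exp (2 * L * (real n * \<tau>))" by (simp add: exp_of_nat_mult[symmetric] algebra_simps)
  also have "\<dots> \<le> exp (2 * L * T)" using assms by simp
  finally have "(n * \<tau>) * ((1 + L * \<tau>)\<^sup>2) ^ n \<le> T * exp (2 * L * T)"
    using assms by (intro mult_mono) (auto intro: order_trans[of 0 "real n * \<tau>"])
  then have "(\<kappa> * (\<tau> powr p)\<^sup>2) * ((n * \<tau>) * ((1 + L * \<tau>)\<^sup>2) ^ n)
      \<le> (\<kappa> * (\<tau> powr p)\<^sup>2) * (T * exp (2 * L * T))"
    using assms by (intro mult_left_mono) auto
  then show ?thesis unfolding powr by (simp add: mult_ac)
qed

section \<open>Convergence of the probabilistic scheme\<close>

theorem theorem3p2:
  fixes T \<alpha> \<beta> L\<^sub>f \<tau>max C\<^sub>d q L\<^sub>\<Psi> C\<^sub>\<xi> p :: real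
    and \<iota> :: "'v::{real_inner, complete_space} \<Rightarrow>\<^sub>L 'h::{real_inner, complete_space}"
    and A :: "'v \<Rightarrow>\<^sub>L 'v \<Rightarrow>\<^sub>L real"
    and B :: "'v \<Rightarrow>\<^sub>L 'q::{real_inner, complete_space} \<Rightarrow>\<^sub>L real"
    and Bm :: "('q \<Rightarrow>\<^sub>L real) \<Rightarrow>\<^sub>L 'v"
    and f :: "real \<Rightarrow> 'v \<Rightarrow> 'h"
    and g :: "real \<Rightarrow> 'q \<Rightarrow>\<^sub>L real"
    and u0 :: 'v and u uker :: "real \<Rightarrow> 'v" and lam :: "real \<Rightarrow> 'q"
    and \<Psi> :: "real \<Rightarrow> real \<Rightarrow> 'v \<Rightarrow> 'v"
    and M :: "'w measure"
    and \<eta> :: "real \<Rightarrow> nat \<Rightarrow> real \<Rightarrow> 'w \<Rightarrow> 'v"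
    and \<sigma> :: "real \<Rightarrow> real"
    and K :: "('v \<Rightarrow>\<^sub>L real) \<Rightarrow>\<^sub>L ('v \<Rightarrow>\<^sub>L real) \<Rightarrow>\<^sub>L real"
  assumes "T > 0"
    and "gelfand_triple \<iota>"
    and "\<beta> > 0" and "inf_sup_condition B \<beta>"
    and "\<alpha> > 0" and "elliptic_on (op_ker B) A \<alpha>"
    and "L\<^sub>f > 0"
    and "\<forall>t\<in>{0..T}. \<forall>v1 v2.
           norm (f t v1 - f t v2) \<le> L\<^sub>f * norm (blinfun_apply \<iota> (v1 - v2))"
    and "\<forall>r. blinfun_apply B (blinfun_apply Bm r) = r"
    and "blinfun_apply B u0 = g 0"
    and "unique_solution T \<iota> A B f g u0 u lam"
    and "\<forall>t\<in>{0..T}. u t = uker t + blinfun_apply Bm (g t) \<and> uker t \<in> op_ker B"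
    and "\<tau>max > 0" and "C\<^sub>d > 0" and "q > 0" and "L\<^sub>\<Psi> > 0"
    and "det_assumption T \<iota> (op_ker B) uker \<Psi> \<tau>max C\<^sub>d q L\<^sub>\<Psi>"
    and "prob_space M" and "covariance_form K"
    and "C\<^sub>\<xi> > 0" and "p > 0"
    and "\<forall>\<tau>. step_size T \<tau> \<and> \<tau> \<le> 1 \<and> \<tau> \<le> \<tau>max \<longrightarrow>
           noise_assumption M \<iota> (op_ker B) \<tau> (\<eta> \<tau>) (\<sigma> \<tau>) K C\<^sub>\<xi> p"
  shows "\<exists>C>0. \<forall>N::nat. \<forall>\<tau>. N \<ge> 1 \<and> \<tau> = T / real N \<and> \<tau> \<le> 1 \<and> \<tau> \<le> \<tau>max \<longrightarrow>
           (\<forall>n\<in>{0..N}. integrable M (\<lambda>\<omega>. (norm (blinfun_apply \<iota>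
               (u (real n * \<tau>) - prob_scheme (\<Psi> \<tau>) \<tau> (\<eta> \<tau>) (uker 0) Bm g n \<omega>)))\<^sup>2)) \<and>
           (SUP n\<in>{0..N}. sqrt (LINT \<omega>|M. (norm (blinfun_apply \<iota>
               (u (real n * \<tau>) - prob_scheme (\<Psi> \<tau>) \<tau> (\<eta> \<tau>) (uker 0) Bm g n \<omega>)))\<^sup>2))
             \<le> C * \<tau> powr min p q"
proof -
  note T = assms(1) and triple = assms(2) and split = assms(12) and pos = assms(14-16,20)
    and det = assms(17) and M = assms(18) and noise = assms(22)
  interpret prob_space M by (rule M)
  let ?W = "op_ker B"
  define C where "C = sqrt (2 * C\<^sub>d\<^sup>2 + 2 * (T * C\<^sub>\<xi> * exp (2 * L\<^sub>\<Psi> * T)))"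
  have C: "C > 0" using T pos by (auto simp: C_def intro!: add_pos_pos)
  have C2: "C\<^sup>2 = 2 * C\<^sub>d\<^sup>2 + 2 * (T * C\<^sub>\<xi> * exp (2 * L\<^sub>\<Psi> * T))"
    unfolding C_def using T pos by (intro real_sqrt_pow2) simp
  have inj: "inj (blinfun_apply \<iota>)" using triple by (simp add: gelfand_triple_def)
  have main: "integrable M (\<lambda>\<omega>. (norm (blinfun_apply \<iota>
        (u (real n * \<tau>) - prob_scheme (\<Psi> \<tau>) \<tau> (\<eta> \<tau>) (uker 0) Bm g n \<omega>)))\<^sup>2)
      \<and> sqrt (LINT \<omega>|M. (norm (blinfun_apply \<iota>
        (u (real n * \<tau>) - prob_scheme (\<Psi> \<tau>) \<tau> (\<eta> \<tau>) (uker 0) Bm g n \<omega>)))\<^sup>2) \<le> C * \<tau> powr min p q"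
    if N: "N \<ge> 1" and \<tau>N: "\<tau> = T / real N" and small: "\<tau> \<le> 1" "\<tau> \<le> \<tau>max" and n: "n \<le> N" for N n \<tau>
  proof -
    have \<tau>: "\<tau> > 0" using T N \<tau>N by simp
    have step: "step_size T \<tau>" using N \<tau>N unfolding step_size_def by blast
    have time: "real k * \<tau> \<in> {0..T}" if "k \<le> N" for k
    proof -
      have "real k * \<tau> \<le> real N * \<tau>" using that \<tau> by (intro mult_right_mono) auto
      also have "\<dots> = T" using N \<tau>N by simp
      finally show ?thesis using \<tau> by simp
    qed
    have noise\<tau>: "noise_assumption M \<iota> ?W \<tau> (\<eta> \<tau>) (\<sigma> \<tau>) K C\<^sub>\<xi> p" using noise step small by blast
    let ?\<xi> = "noise_integral (\<eta> \<tau>)"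
    let ?d = "det_scheme (\<Psi> \<tau>) \<tau> (uker 0)"
    let ?U = "prob_scheme_ker (\<Psi> \<tau>) \<tau> (\<eta> \<tau>) (uker 0)"
    have \<Psi>W: "\<Psi> \<tau> t v \<in> ?W" if "t \<in> {0..T}" "v \<in> ?W" for t v
      using det step small that unfolding det_assumption_def by blast
    have \<Psi>L: "norm (blinfun_apply \<iota> (\<Psi> \<tau> t v1 - \<Psi> \<tau> t v2))
        \<le> (1 + L\<^sub>\<Psi> * \<tau>) * norm (blinfun_apply \<iota> (v1 - v2))"
      if "t \<in> {0..T}" "v1 \<in> ?W" "v2 \<in> ?W" for t v1 v2
      using det step small that unfolding det_assumption_def by blast
    have det_err: "norm (blinfun_apply \<iota> (uker (real n * \<tau>) - ?d n)) \<le> C\<^sub>d * \<tau> powr q"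
      using det step small time[OF n] unfolding det_assumption_def by auto
    have start: "uker 0 \<in> ?W" using split T by auto
    have \<xi>W: "?\<xi> k \<tau> \<omega> \<in> ?W" if "\<omega> \<in> space M" for k \<omega>
      unfolding noise_integral_def
      by (rule integral_in_op_ker) (use noise\<tau> that in \<open>auto simp: noise_assumption_def\<close>)
    have dW: "?d k \<in> ?W" if "k \<le> N" for k
      using that by (induction k) (use start \<Psi>W time in auto)
    have UW: "?U k \<omega> \<in> ?W" if "k \<le> N" "\<omega> \<in> space M" for k \<omega>
      using that(1)
    proof (induction k)
      case (Suc k)
      then have "\<Psi> \<tau> (real k * \<tau>) (?U k \<omega>) \<in> ?W" by (intro \<Psi>W time) auto
      then show ?case using \<xi>W[OF that(2), of k] by (simp add: op_ker_def blinfun.add_right)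
    qed (use start in simp)
    \<comment> \<open>the one-step map seen in \<open>'h\<close>, where it is Lipschitz; this is well defined since \<open>\<iota>\<close> is injective\<close>
    define \<Phi> where "\<Phi> k y = blinfun_apply \<iota> (\<Psi> \<tau> (real k * \<tau>) (inv (blinfun_apply \<iota>) y))" for k y
    have \<Phi>: "\<Phi> k (blinfun_apply \<iota> v) = blinfun_apply \<iota> (\<Psi> \<tau> (real k * \<tau>) v)" for k v
      by (simp add: \<Phi>_def inv_f_f[OF inj])
    let ?c = "\<lambda>k. blinfun_apply \<iota> (?d k)" and ?X = "\<lambda>k \<omega>. blinfun_apply \<iota> (?U k \<omega>)"
    let ?\<kappa> = "C\<^sub>\<xi> * \<tau> powr (2 * p + 1)"
    let ?G = "\<lambda>n. ae_completion M (path_algebra M \<tau> (\<eta> \<tau>) {..<n})"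
    have sub: "subalgebra M (?G n)" "subalgebra (?G (Suc n)) (?G n)" for n
      by (rule past_subalgebra[OF M noise\<tau> \<tau>])+
    have unc: "(LINT \<omega>|M. indicator A \<omega> * (h \<bullet> blinfun_apply \<iota> (?\<xi> k \<tau> \<omega>))) = 0" if "A \<in> sets (?G k)" for k h A
      using noise_integral_uncorrelated_past[OF M noise\<tau> \<tau> that, of "blinfun_inner_right h o\<^sub>L \<iota>"] by simp
    have "strongly_measurable (?G n) (?X n) \<and>
        integrable M (\<lambda>\<omega>. (norm (?c n - ?X n \<omega>))\<^sup>2) \<and>
        (LINT \<omega>|M. (norm (?c n - ?X n \<omega>))\<^sup>2) \<le> n * ?\<kappa> * ((1 + L\<^sub>\<Psi> * \<tau>)\<^sup>2) ^ n"
    proof (rule mean_square_perturbation[where G = ?G and X = ?X and c = ?c and N = N and \<Phi> = \<Phi> and S = "blinfun_apply \<iota> ` ?W"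
            and \<xi> = "\<lambda>k \<omega>. blinfun_apply \<iota> (?\<xi> k \<tau> \<omega>)", OF finite_measure_axioms])
      show "norm (\<Phi> k x - \<Phi> k y) \<le> (1 + L\<^sub>\<Psi> * \<tau>) * norm (x - y)"
        if "k < N" "x \<in> blinfun_apply \<iota> ` ?W" "y \<in> blinfun_apply \<iota> ` ?W" for k x y
      proof -
        obtain v w where "v \<in> ?W" "w \<in> ?W" "x = blinfun_apply \<iota> v" "y = blinfun_apply \<iota> w"
          using \<open>x \<in> _\<close> \<open>y \<in> _\<close> by blast
        then show ?thesis using \<Psi>L[of "real k * \<tau>" v w] time[of k] \<open>k < N\<close> by (simp add: \<Phi> blinfun.diff_right)
      qed
      show "strongly_measurable (?G (Suc k)) (\<lambda>\<omega>. blinfun_apply \<iota> (?\<xi> k \<tau> \<omega>))" for k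
        by (rule noise_integral_strongly_past[OF M noise\<tau> \<tau>]) simp
      show "integrable M (\<lambda>\<omega>. (norm (blinfun_apply \<iota> (?\<xi> k \<tau> \<omega>)))\<^sup>2)"
        "(LINT \<omega>|M. (norm (blinfun_apply \<iota> (?\<xi> k \<tau> \<omega>)))\<^sup>2) \<le> ?\<kappa>" for k
        using noise\<tau> \<tau> unfolding noise_assumption_def by auto
      show "1 \<le> 1 + L\<^sub>\<Psi> * \<tau>" using pos \<tau> by simp
    qed (use n dW UW unc sub in \<open>auto simp: \<Phi> blinfun.add_right\<close>)
    then have sm: "strongly_measurable (?G n) (?X n)"
      and int: "integrable M (\<lambda>\<omega>. (norm (?c n - ?X n \<omega>))\<^sup>2)"
      and le: "(LINT \<omega>|M. (norm (?c n - ?X n \<omega>))\<^sup>2) \<le> n * ?\<kappa> * ((1 + L\<^sub>\<Psi> * \<tau>)\<^sup>2) ^ n" by auto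
    let ?a = "blinfun_apply \<iota> (uker (real n * \<tau>) - ?d n)"
    let ?e = "\<lambda>\<omega>. blinfun_apply \<iota> (u (real n * \<tau>) - prob_scheme (\<Psi> \<tau>) \<tau> (\<eta> \<tau>) (uker 0) Bm g n \<omega>)"
    have e: "?e \<omega> = blinfun_apply \<iota> (uker (real n * \<tau>)) - ?X n \<omega>" for \<omega>
      using split time[OF n] by (simp add: prob_scheme_def blinfun.diff_right blinfun.add_right)
    have e': "?e \<omega> = ?a + (?c n - ?X n \<omega>)" for \<omega> unfolding e by (simp add: blinfun.diff_right)
    have e_le: "(norm (?e \<omega>))\<^sup>2 \<le> 2 * (norm ?a)\<^sup>2 + 2 * (norm (?c n - ?X n \<omega>))\<^sup>2" for \<omega>
      unfolding e' by (rule square_norm_add_le)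
    have dom: "integrable M (\<lambda>\<omega>. 2 * (norm ?a)\<^sup>2 + 2 * (norm (?c n - ?X n \<omega>))\<^sup>2)"
      using int by simp
    have e_int: "integrable M (\<lambda>\<omega>. (norm (?e \<omega>))\<^sup>2)"
    proof (rule Bochner_Integration.integrable_bound[OF dom])
      have "?X n \<in> borel_measurable M"
        using strongly_measurable_subalgebra[OF sub(1) sm] unfolding strongly_measurable_def by simp
      moreover have "(\<lambda>y. (norm (blinfun_apply \<iota> (uker (real n * \<tau>)) - y))\<^sup>2) \<in> borel_measurable borel"
        by (intro borel_measurable_continuous_onI continuous_intros)
      ultimately show "(\<lambda>\<omega>. (norm (?e \<omega>))\<^sup>2) \<in> borel_measurable M"
        unfolding e by (rule measurable_compose)
    qed (use e_le in auto)
    \<comment> \<open>\<open>\<tau> \<le> 1\<close> makes the smaller exponent the dominant one\<close>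
    have mono: "\<tau> powr p \<le> \<tau> powr min p q" "\<tau> powr q \<le> \<tau> powr min p q"
      using small(1) \<tau> by (auto intro!: powr_mono')
    have "(LINT \<omega>|M. (norm (?e \<omega>))\<^sup>2) \<le> (LINT \<omega>|M. 2 * (norm ?a)\<^sup>2 + 2 * (norm (?c n - ?X n \<omega>))\<^sup>2)"
      by (rule integral_mono[OF e_int dom e_le])
    also have "\<dots> = 2 * (norm ?a)\<^sup>2 + 2 * (LINT \<omega>|M. (norm (?c n - ?X n \<omega>))\<^sup>2)"
      using int by (simp add: prob_space)
    also have "(norm ?a)\<^sup>2 \<le> (C\<^sub>d * \<tau> powr min p q)\<^sup>2"
      using det_err mono(2) pos(1)
      by (intro power_mono) (auto intro: order_trans[OF _ mult_left_mono[OF mono(2)]])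
    also have "(LINT \<omega>|M. (norm (?c n - ?X n \<omega>))\<^sup>2)
        \<le> T * C\<^sub>\<xi> * exp (2 * L\<^sub>\<Psi> * T) * (\<tau> powr min p q)\<^sup>2"
    proof -
      note le
      also have "n * ?\<kappa> * ((1 + L\<^sub>\<Psi> * \<tau>)\<^sup>2) ^ n \<le> T * C\<^sub>\<xi> * exp (2 * L\<^sub>\<Psi> * T) * (\<tau> powr p)\<^sup>2"
        by (rule discrete_gronwall_bound) (use \<tau> pos time[OF n] in auto)
      also have "\<dots> \<le> T * C\<^sub>\<xi> * exp (2 * L\<^sub>\<Psi> * T) * (\<tau> powr min p q)\<^sup>2"
        using T pos mono(1) by (intro mult_left_mono power_mono) auto
      finally show ?thesis .
    qed
    finally have "(LINT \<omega>|M. (norm (?e \<omega>))\<^sup>2) \<le> (C * \<tau> powr min p q)\<^sup>2"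
      by (simp add: power_mult_distrib C2 algebra_simps)
    then have "sqrt (LINT \<omega>|M. (norm (?e \<omega>))\<^sup>2) \<le> C * \<tau> powr min p q"
      using C by (intro real_le_lsqrt) auto
    with e_int show ?thesis by blast
  qed
  show ?thesis
  proof (intro exI[of _ C] conjI C allI impI ballI)
    fix N :: nat and \<tau> n assume "N \<ge> 1 \<and> \<tau> = T / real N \<and> \<tau> \<le> 1 \<and> \<tau> \<le> \<tau>max" "n \<in> {0..N}"
    then show "integrable M (\<lambda>\<omega>. (norm (blinfun_apply \<iota>
        (u (real n * \<tau>) - prob_scheme (\<Psi> \<tau>) \<tau> (\<eta> \<tau>) (uker 0) Bm g n \<omega>)))\<^sup>2)"
      by (intro main[of N \<tau> n, THEN conjunct1]) auto
  next
    fix N :: nat and \<tau> assume "N \<ge> 1 \<and> \<tau> = T / real N \<and> \<tau> \<le> 1 \<and> \<tau> \<le> \<tau>max"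
    then show "(SUP n\<in>{0..N}. sqrt (LINT \<omega>|M. (norm (blinfun_apply \<iota>
        (u (real n * \<tau>) - prob_scheme (\<Psi> \<tau>) \<tau> (\<eta> \<tau>) (uker 0) Bm g n \<omega>)))\<^sup>2)) \<le> C * \<tau> powr min p q"
      by (intro cSUP_least main[of N \<tau>, THEN conjunct2]) auto
  qed
qed

end
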